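(* If $P\subset\mathbb{R}^3$ is an equiprojective polytope, then $P$ is $k$-equiprojective with $$k=\sum_{u}\mu_P(u),$$ where the sum ranges over the edge directions $u$ of $P$.
   Context: A $3$-dimensional polytope $P\subset\mathbb{R}^3$ is $k$-equiprojective when its orthogonal projection onto any plane not orthogonal to a facet of $P$ is a polygon with exactly $k$ vertices; equiprojective means $k$-equiprojective for some $k$. For a face $F$ of a polytope $P\subset\mathbb{R}^3$, $N_P(F)=\{u\in\mathbb{R}^3:\ u\cdot x\le u\cdot y\ \forall x\in P, y\in F\}$. For non-zero $u$, the aggregated cone $C_P(u)$ is the union of the $2$-dimensional normal cones of $P$ contained in the plane $u^\perp$. A vector $u\in\mathbb{S}^2$ is an edge direction of $P$ when its first non-zero coordinate is positive and some edge of $P$ has difference of vertices a multiple of $u$. The multiplicity $\mu_P(u)$ of an edge direction $u$ is $2$ if $C_P(u)=u^\perp$ and $1$ otherwise. *)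

theory Defs
  imports "HOL-Analysis.Analysis"
begin

definition proj_plane :: "real^3 \<Rightarrow> real^3 \<Rightarrow> real^3" where
  "proj_plane n x = x - ((x \<bullet> n) / (n \<bullet> n)) *\<^sub>R n"

text \<open>The plane with normal n is orthogonal to the facet F iff n lies in the
  direction space of F (i.e. the normals of the two planes are orthogonal).\<close>
definition plane_orth_facet :: "real^3 \<Rightarrow> (real^3) set \<Rightarrow> bool" where
  "plane_orth_facet n F \<longleftrightarrow> n \<in> span {x - y | x y. x \<in> F \<and> y \<in> F}"

definition k_equiprojective :: "(real^3) set \<Rightarrow> nat \<Rightarrow> bool" where
  "k_equiprojective P k \<longleftrightarrow>
     (\<forall>n. n \<noteq> 0 \<longrightarrow> (\<forall>F. F facet_of P \<longrightarrow> \<not> plane_orth_facet n F) \<longrightarrow>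
        card {v. v extreme_point_of (proj_plane n ` P)} = k)"

definition equiprojective :: "(real^3) set \<Rightarrow> bool" where
  "equiprojective P \<longleftrightarrow> (\<exists>k. k_equiprojective P k)"

definition normal_cone :: "(real^3) set \<Rightarrow> (real^3) set \<Rightarrow> (real^3) set" where
  "normal_cone P F = {u. \<forall>x\<in>P. \<forall>y\<in>F. u \<bullet> x \<le> u \<bullet> y}"

definition aggregated_cone :: "(real^3) set \<Rightarrow> real^3 \<Rightarrow> (real^3) set" where
  "aggregated_cone P u = \<Union> {normal_cone P F | F. F face_of P \<and>
       aff_dim (normal_cone P F) = 2 \<and> normal_cone P F \<subseteq> {x. x \<bullet> u = 0}}"

definition first_nonzero_pos :: "real^3 \<Rightarrow> bool" where
  "first_nonzero_pos u \<longleftrightarrow> u$1 > 0 \<or> (u$1 = 0 \<and> u$2 > 0) \<or> (u$1 = 0 \<and> u$2 = 0 \<and> u$3 > 0)"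

definition edge_direction :: "(real^3) set \<Rightarrow> real^3 \<Rightarrow> bool" where
  "edge_direction P u \<longleftrightarrow> norm u = 1 \<and> first_nonzero_pos u \<and>
     (\<exists>E x y c. E face_of P \<and> aff_dim E = 1 \<and> x extreme_point_of E \<and> y extreme_point_of E \<and>
        x \<noteq> y \<and> x - y = c *\<^sub>R u)"

definition multiplicity :: "(real^3) set \<Rightarrow> real^3 \<Rightarrow> nat" where
  "multiplicity P u = (if aggregated_cone P u = {x. x \<bullet> u = 0} then 2 else 1)"

end

theory Submission
  imports Defs
begin

text \<open>For a direction \<open>n\<close> that is not parallel to a facet, the vertices of the projection along \<open>n\<close>
  are equinumerous with its edges, hence with the rays of the plane orthogonal to \<open>n\<close> that meet
  the normal cone of an edge of \<open>P\<close>. Grouping the edges by their direction \<open>u\<close>, this number is the sum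
  over \<open>u\<close> of the number of rays of the line spanned by \<open>n \<times> u\<close> that lie in the aggregated cone of \<open>u\<close>.
  If the sum does not depend on \<open>n\<close>, then no summand does: when \<open>n\<close> crosses the plane of a facet
  with normal \<open>w\<close>, the summands of the directions \<open>v\<close> parallel to the facet jump, the sign of the jump
  of \<open>v\<close> being determined by the side of the line spanned by \<open>v\<close> on which \<open>n\<close> lies in that plane.
  Comparing two crossings on either side of that line, and close to it, shows that the jump of \<open>v\<close> vanishes.
  So each summand is constant; it is positive, and it equals 2 exactly if the aggregated cone is
  the whole plane.\<close>

unbundle cross3_syntax

section \<open>Faces supported by a direction\<close>

text \<open>The exposed face with outer normal \<open>w\<close>; for \<open>w = 0\<close> it is all
  of \<open>S\<close>.\<close>

definition support_face :: "'a::real_inner set \<Rightarrow> 'a \<Rightarrow> 'a set" where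
  "support_face S w = {x \<in> S. \<forall>y\<in>S. w \<bullet> y \<le> w \<bullet> x}"

lemma support_face_subset: "support_face S w \<subseteq> S"
  by (auto simp: support_face_def)

lemma inner_eq_on_support_face:
  "x \<in> support_face S w \<Longrightarrow> y \<in> support_face S w \<Longrightarrow> w \<bullet> x = w \<bullet> y"
  by (simp add: support_face_def order_antisym)

lemma support_face_eq_Int_hyperplane:
  assumes "x \<in> support_face S w"
  shows "support_face S w = S \<inter> {y. w \<bullet> y = w \<bullet> x}"
  using assms by (auto simp: support_face_def intro!: order_antisym)

lemma support_face_scaleR:
  assumes "0 < c" shows "support_face S (c *\<^sub>R w) = support_face S w"
  using assms by (simp add: support_face_def)

lemma support_face_face_of:
  assumes "convex S" shows "support_face S w face_of S"
proof (cases "support_face S w = {}")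
  case False
  then obtain x where x: "x \<in> support_face S w" by blast
  show ?thesis
    unfolding support_face_eq_Int_hyperplane[OF x]
    by (rule face_of_Int_supporting_hyperplane_le) (use assms x in \<open>auto simp: support_face_def\<close>)
qed simp

lemma support_face_nonempty:
  assumes "compact S" "S \<noteq> {}" shows "support_face S w \<noteq> {}"
proof -
  have "continuous_on S (\<lambda>x. w \<bullet> x)" by (intro continuous_intros)
  then show ?thesis
    using continuous_attains_sup[OF assms] by (auto simp: support_face_def)
qed

text \<open>A face of the hull is spanned by points of \<open>V\<close>, which must then maximise
  \<open>w\<close>; conversely, a half-space containing \<open>V\<close> contains the hull.\<close>

lemma support_face_convex_hull:
  fixes V :: "'a::euclidean_space set"
  assumes "finite V"
  shows "support_face (convex hull V) w = convex hull (support_face V w)"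
proof
  have "support_face (convex hull V) w face_of convex hull V"
    by (simp add: support_face_face_of)
  then obtain V' where V': "V' \<subseteq> V" "support_face (convex hull V) w = convex hull V'"
    by (meson assms face_of_convex_hull_subset finite_imp_compact)
  have "V' \<subseteq> support_face V w"
  proof
    fix x assume "x \<in> V'"
    then have "x \<in> support_face (convex hull V) w" "x \<in> V"
      using V' by (auto simp: hull_inc)
    then show "x \<in> support_face V w"
      by (auto simp: support_face_def hull_inc)
  qed
  then show "support_face (convex hull V) w \<subseteq> convex hull (support_face V w)"
    using V'(2) hull_mono by metis
next
  have "support_face V w \<subseteq> support_face (convex hull V) w"
  proof
    fix x assume x: "x \<in> support_face V w"
    have "convex hull V \<subseteq> {y. w \<bullet> y \<le> w \<bullet> x}"
      using x by (intro hull_minimal) (auto simp: support_face_def convex_halfspace_le)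
    then show "x \<in> support_face (convex hull V) w"
      using x by (auto simp: support_face_def hull_inc)
  qed
  moreover have "convex (support_face (convex hull V) w)"
    using support_face_face_of face_of_imp_convex convex_convex_hull by blast
  ultimately show "convex hull (support_face V w) \<subseteq> support_face (convex hull V) w"
    by (simp add: hull_minimal)
qed

text \<open>Strict inequalities between the finitely many generating points survive a small
  perturbation, and \<open>z\<close> decides the ties. One-sided limits thereby become iterated
  support faces, on which the whole analysis of jumps rests.\<close>

lemma eventually_support_face_perturb:
  fixes S :: "'a::euclidean_space set"
  assumes "polytope S"
  shows "\<forall>\<^sub>F s in at_right 0.
           support_face S (w + s *\<^sub>R z) = support_face (support_face S w) z"
proof -
  obtain V where V: "finite V" "S = convex hull V"
    using assms by (auto simp: polytope_def)
  have "\<forall>\<^sub>F s in at_right (0::real). w \<bullet> p < w \<bullet> q \<longrightarrow> (w + s *\<^sub>R z) \<bullet> p < (w + s *\<^sub>R z) \<bullet> q" for p q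
  proof (cases "w \<bullet> p < w \<bullet> q")
    case True
    have "((\<lambda>s. (w + s *\<^sub>R z) \<bullet> q - (w + s *\<^sub>R z) \<bullet> p) \<longlongrightarrow>
             (w + 0 *\<^sub>R z) \<bullet> q - (w + 0 *\<^sub>R z) \<bullet> p) (at_right (0::real))"
      by (intro tendsto_intros)
    then have "\<forall>\<^sub>F s in at_right (0::real). 0 < (w + s *\<^sub>R z) \<bullet> q - (w + s *\<^sub>R z) \<bullet> p"
      by (rule order_tendstoD) (use True in simp)
    then show ?thesis by eventually_elim simp
  qed simp
  then have "\<forall>\<^sub>F s in at_right (0::real). \<forall>p\<in>V. \<forall>q\<in>V.
     w \<bullet> p < w \<bullet> q \<longrightarrow> (w + s *\<^sub>R z) \<bullet> p < (w + s *\<^sub>R z) \<bullet> q"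
    by (intro eventually_ball_finite ballI V)
  moreover have "\<forall>\<^sub>F s in at_right (0::real). 0 < s"
    by (simp add: eventually_at_right_less)
  ultimately show ?thesis
  proof eventually_elim
    case (elim s)
    have "support_face V (w + s *\<^sub>R z) = support_face (support_face V w) z"
    proof (cases "V = {}")
      case False
      then obtain m where m: "m \<in> support_face V w"
        using support_face_nonempty[of V w] V finite_imp_compact by blast
      show ?thesis
      proof (intro set_eqI iffI)
        fix x assume x: "x \<in> support_face V (w + s *\<^sub>R z)"
        \<comment> \<open>A point beaten with respect to \<open>w\<close> is still beaten after the
          perturbation.\<close>
        have xw: "x \<in> support_face V w"
        proof (rule ccontr)
          assume "x \<notin> support_face V w"
          then obtain q where "q \<in> V" "w \<bullet> x < w \<bullet> q"
            using x by (force simp: support_face_def)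
          then show False using elim x by (force simp: support_face_def)
        qed
        have "z \<bullet> y \<le> z \<bullet> x" if y: "y \<in> support_face V w" for y
        proof -
          have "(w + s *\<^sub>R z) \<bullet> y \<le> (w + s *\<^sub>R z) \<bullet> x"
            using x y by (auto simp: support_face_def)
          then have "s * (z \<bullet> y) \<le> s * (z \<bullet> x)"
            using inner_eq_on_support_face[OF xw y] by (simp add: inner_add_left)
          then show ?thesis using elim(2) by simp
        qed
        then show "x \<in> support_face (support_face V w) z"
          using xw by (subst support_face_def) auto
      next
        fix x assume x: "x \<in> support_face (support_face V w) z"
        then have xw: "x \<in> support_face V w" and
          zx: "\<And>y. y \<in> support_face V w \<Longrightarrow> z \<bullet> y \<le> z \<bullet> x"
          by (auto simp: support_face_def[of "support_face V w"])
        have "(w + s *\<^sub>R z) \<bullet> y \<le> (w + s *\<^sub>R z) \<bullet> x" if y: "y \<in> V" for y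
        proof (cases "y \<in> support_face V w")
          case True
          then show ?thesis
            using inner_eq_on_support_face[OF xw True] zx[OF True] elim(2)
            by (simp add: inner_add_left)
        next
          case False
          then have "w \<bullet> y < w \<bullet> x" using xw y by (force simp: support_face_def)
          then show ?thesis using elim(1) xw y by (force simp: support_face_def)
        qed
        then show "x \<in> support_face V (w + s *\<^sub>R z)"
          using xw by (auto simp: support_face_def)
      qed
    qed (simp add: support_face_def)
    moreover have "finite (support_face V w)"
      using V(1) support_face_subset finite_subset by metis
    ultimately show ?case
      by (simp add: V support_face_convex_hull)
  qed
qed

section \<open>Affine functions of one parameter and cross products\<close>

lemma eventually_affine_nonzero:
  fixes p q :: real
  assumes "p \<noteq> 0 \<or> q \<noteq> 0"
  shows "\<forall>\<^sub>F s in at 0. p + s * q \<noteq> 0"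
proof (cases "p = 0")
  case True
  then show ?thesis using assms by (auto simp: eventually_at_filter)
next
  case False
  have "((\<lambda>s. p + s * q) \<longlongrightarrow> p + 0 * q) (at 0)" by (intro tendsto_intros)
  then show ?thesis by (rule tendsto_imp_eventually_ne) (use False in simp)
qed

lemma cross_eq_0_imp_scaleR:
  fixes m w :: "real^3"
  assumes "m \<times> w = 0" "m \<noteq> 0" obtains c where "w = c *\<^sub>R m"
proof
  show "w = ((m \<bullet> w) / (m \<bullet> m)) *\<^sub>R m"
    by (rule cross_dot_cancel[OF _ _ assms(2)]) (use assms in \<open>auto simp: cross_mult_right\<close>)
qed

lemma orthogonal_both_imp_scaleR_cross:
  fixes w n v :: "real^3"
  assumes "w \<bullet> n = 0" "w \<bullet> v = 0" "n \<times> v \<noteq> 0" obtains c where "w = c *\<^sub>R (n \<times> v)"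
proof -
  have "(n \<times> v) \<times> w = (n \<bullet> w) *\<^sub>R v - (v \<bullet> w) *\<^sub>R n"
    using exhaust_3 by (force simp: cross3_simps)
  then have "(n \<times> v) \<times> w = 0" using assms by (simp add: inner_commute)
  then show thesis using cross_eq_0_imp_scaleR assms(3) that by metis
qed

lemma triple_cross_left:
  fixes n w :: "real^3"
  assumes "w \<bullet> n = 0"
  shows "(n \<times> w) \<times> n = (n \<bullet> n) *\<^sub>R w"
proof -
  have "(n \<times> w) \<times> n = (n \<bullet> n) *\<^sub>R w - (w \<bullet> n) *\<^sub>R n"
    using exhaust_3 by (force simp: cross3_simps)
  then show ?thesis using assms by simp
qed

lemma cross_nonzero_if_orthogonal:
  fixes n w :: "real^3"
  assumes "w \<bullet> n = 0" "n \<noteq> 0" "w \<noteq> 0" shows "n \<times> w \<noteq> 0"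
  using norm_and_cross_eq_0[of n w] assms by (auto simp: inner_commute)

lemma norm_eq_1_scaleR_cases:
  assumes "norm w = 1" "norm w' = 1" "w = c *\<^sub>R w'"
  shows "w = w' \<or> w = - w'"
proof -
  have "\<bar>c\<bar> = 1" using assms by simp
  then have "c = 1 \<or> c = -1" by linarith
  then show ?thesis using assms by auto
qed

section \<open>Segments parallel to a given vector\<close>

definition edge_along :: "'a::real_vector set \<Rightarrow> 'a \<Rightarrow> bool" where
  "edge_along E v \<longleftrightarrow> (\<exists>x\<in>E. \<exists>y\<in>E. x \<noteq> y) \<and> (\<forall>x\<in>E. \<forall>y\<in>E. \<exists>c. x - y = c *\<^sub>R v)"

lemma edge_along_imp_collinear: "edge_along E v \<Longrightarrow> collinear E"
  by (auto simp: edge_along_def collinear_def)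

text \<open>Collinearity transfers the direction of one chord to all of \<open>E\<close>, since the
  common direction \<open>d\<close> is itself a multiple of \<open>v\<close>.\<close>

lemma edge_along_if_collinear:
  assumes "collinear E" "x \<in> E" "y \<in> E" "x \<noteq> y" "x - y = c *\<^sub>R v"
  shows "edge_along E v"
proof -
  obtain d where d: "\<And>x y. x \<in> E \<Longrightarrow> y \<in> E \<Longrightarrow> \<exists>c. x - y = c *\<^sub>R d"
    using assms(1) by (auto simp: collinear_def)
  obtain c' where c': "x - y = c' *\<^sub>R d" using d assms by blast
  then have "c' \<noteq> 0" using assms(4) by auto
  then have "d = (c / c') *\<^sub>R v"
    using arg_cong[OF c'[unfolded assms(5)], of "\<lambda>v. inverse c' *\<^sub>R v"]
    by (simp add: divide_inverse mult.commute)
  then have "\<exists>c. a - b = c *\<^sub>R v" if "a \<in> E" "b \<in> E" for a b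
    using d[OF that] by auto
  then show ?thesis using assms by (auto simp: edge_along_def)
qed

lemma edge_along_inner:
  assumes "edge_along E v" "z \<bullet> v = 0" "x \<in> E" "y \<in> E"
  shows "z \<bullet> x = z \<bullet> y"
proof -
  obtain c where "x - y = c *\<^sub>R v" using assms by (auto simp: edge_along_def)
  then have "z \<bullet> (x - y) = 0" using assms(2) by simp
  then show ?thesis by (simp add: inner_diff_right)
qed

lemma edge_along_support_face_orthogonal:
  assumes "edge_along (support_face P w) v" shows "w \<bullet> v = 0"
proof -
  obtain x y c where *: "x \<in> support_face P w" "y \<in> support_face P w" "x \<noteq> y" "x - y = c *\<^sub>R v"
    using assms unfolding edge_along_def by blast
  have "c * (w \<bullet> v) = w \<bullet> (x - y)" using *(4) by simp
  also have "\<dots> = 0" using inner_eq_on_support_face[OF *(1,2)] by (simp add: inner_diff_right)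
  finally show ?thesis using * by auto
qed

lemma support_face_eq_self:
  assumes "\<And>x y. x \<in> E \<Longrightarrow> y \<in> E \<Longrightarrow> z \<bullet> x = z \<bullet> y"
  shows "support_face E z = E"
  unfolding support_face_def using assms eq_refl by blast

text \<open>If \<open>E\<close> is parallel to \<open>v\<close>, then \<open>z\<close> is constant
  on \<open>E\<close> and cuts nothing off; if the smaller face has a chord along \<open>v\<close>,
  collinearity gives \<open>E\<close> the same direction.\<close>

lemma edge_along_support_face_collinear:
  assumes "collinear E" "z \<bullet> v = 0"
  shows "edge_along (support_face E z) v \<longleftrightarrow> edge_along E v"
proof
  assume "edge_along (support_face E z) v"
  then obtain x y c where "x \<in> E" "y \<in> E" "x \<noteq> y" "x - y = c *\<^sub>R v"
    using support_face_subset unfolding edge_along_def by blast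
  then show "edge_along E v" using edge_along_if_collinear assms by blast
next
  assume *: "edge_along E v"
  then have "support_face E z = E"
    using support_face_eq_self edge_along_inner assms(2) by metis
  with * show "edge_along (support_face E z) v" by simp
qed

text \<open>On its own support face \<open>w\<close> is constant, so adding any multiple of it
  leaves the order of the values unchanged.\<close>

lemma support_face_support_face_combination:
  assumes "0 < b"
  shows "support_face (support_face S w) (a *\<^sub>R w + b *\<^sub>R z) = support_face (support_face S w) z"
proof -
  have "(a *\<^sub>R w + b *\<^sub>R z) \<bullet> y \<le> (a *\<^sub>R w + b *\<^sub>R z) \<bullet> x \<longleftrightarrow> z \<bullet> y \<le> z \<bullet> x"
    if "x \<in> support_face S w" "y \<in> support_face S w" for x y
    using inner_eq_on_support_face[OF that] assms by (simp add: inner_add_left)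
  then show ?thesis by (auto simp: support_face_def[of "support_face S w"])
qed

text \<open>Chords of the iterated face are orthogonal to both \<open>w\<close> and
  \<open>z\<close>.\<close>

lemma collinear_support_face_support_face:
  fixes w z :: "real^3"
  assumes "w \<times> z \<noteq> 0" shows "collinear (support_face (support_face S w) z)"
  unfolding collinear_def
proof (intro exI[of _ "w \<times> z"] ballI)
  fix x y assume *: "x \<in> support_face (support_face S w) z" "y \<in> support_face (support_face S w) z"
  then have "w \<bullet> x = w \<bullet> y" "z \<bullet> x = z \<bullet> y"
    using inner_eq_on_support_face support_face_subset by blast+
  then have "(x - y) \<bullet> w = 0" "(x - y) \<bullet> z = 0"
    by (metis inner_commute inner_diff_right right_minus_eq)+
  then show "\<exists>c. x - y = c *\<^sub>R (w \<times> z)"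
    using orthogonal_both_imp_scaleR_cross assms by blast
qed

section \<open>Edges and vertices of a polygon\<close>

text \<open>Sending the outer normal of an edge to the clockwise end of that edge is a bijection from
  the edges of a polygon to its vertices.\<close>

lemma card_extreme_points_polygon:
  fixes Q :: "(real^3) set" and n :: "real^3"
  assumes Q: "polytope Q" and n: "n \<noteq> 0"
    and planar: "\<And>x y. x \<in> Q \<Longrightarrow> y \<in> Q \<Longrightarrow> n \<bullet> x = n \<bullet> y"
    and nonflat: "\<And>w. w \<noteq> 0 \<Longrightarrow> w \<bullet> n = 0 \<Longrightarrow> \<exists>x\<in>Q. \<exists>y\<in>Q. w \<bullet> x \<noteq> w \<bullet> y"
  shows "card {p. p extreme_point_of Q} =
    card {w. norm w = 1 \<and> w \<bullet> n = 0 \<and> (\<exists>x\<in>support_face Q w. \<exists>y\<in>support_face Q w. x \<noteq> y)}"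
    (is "_ = card ?S")
proof -
  \<comment> \<open>Along an edge with outer normal \<open>w\<close>, the vector
    \<open>w \<times> n\<close> points to the clockwise end; \<open>G w\<close> consists of that
    end.\<close>
  define G where "G w = support_face (support_face Q w) (w \<times> n)" for w
  have nw: "n \<times> w \<noteq> 0" if "w \<in> ?S" for w
    using that n by (intro cross_nonzero_if_orthogonal) auto
  have poly: "polytope (support_face Q w)" for w
    using Q face_of_polytope_polytope polytope_imp_convex support_face_face_of by blast
  have diff: "\<exists>c. x - y = c *\<^sub>R (n \<times> w)" if "w \<in> ?S" "x \<in> support_face Q w" "y \<in> support_face Q w" for w x y
  proof -
    have "w \<bullet> x = w \<bullet> y" "n \<bullet> x = n \<bullet> y"
      using that planar support_face_subset inner_eq_on_support_face by blast+
    then have "(x - y) \<bullet> n = 0" "(x - y) \<bullet> w = 0"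
      by (metis inner_commute inner_diff_right right_minus_eq)+
    then show ?thesis using orthogonal_both_imp_scaleR_cross nw[OF that(1)] by blast
  qed
  have unique: "x = y" if w: "w \<in> ?S" and xy: "x \<in> G w" "y \<in> G w" for w x y
  proof -
    obtain c where c: "x - y = c *\<^sub>R (n \<times> w)"
      using diff[OF w] xy support_face_subset unfolding G_def by blast
    have "(w \<times> n) \<bullet> x = (w \<times> n) \<bullet> y"
      using xy inner_eq_on_support_face unfolding G_def by blast
    then have "(w \<times> n) \<bullet> (x - y) = 0" by (simp add: inner_diff_right)
    then have "c * ((w \<times> n) \<bullet> (n \<times> w)) = 0" by (simp add: c)
    moreover have "(w \<times> n) \<bullet> (n \<times> w) \<noteq> 0"
      using nw[OF w] cross_skew[of w n] by simp
    ultimately show ?thesis using c by simp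
  qed
  have G_single: "\<exists>p. G w = {p} \<and> p extreme_point_of Q" if w: "w \<in> ?S" for w
  proof -
    have "support_face Q w \<noteq> {}" using w by blast
    then have "G w \<noteq> {}"
      unfolding G_def using poly polytope_imp_compact support_face_nonempty by blast
    then obtain p where p: "G w = {p}" using unique[OF w] by blast
    have "G w face_of Q"
      unfolding G_def using Q poly polytope_imp_convex support_face_face_of face_of_trans by metis
    with p show ?thesis by (auto simp: face_of_singleton)
  qed
  define f where "f w = (THE p. G w = {p})" for w
  have f: "G w = {f w}" if "w \<in> ?S" for w
    using G_single[OF that] unfolding f_def by auto
  \<comment> \<open>Seen from its clockwise end, the edge runs in direction
    \<open>n \<times> w\<close>.\<close>
  have towards: "\<exists>q\<in>Q. \<exists>c>0. q - p = c *\<^sub>R (n \<times> w)" if w: "w \<in> ?S" and p: "G w = {p}" for w p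
  proof -
    have pw: "p \<in> support_face Q w" and
      le: "\<And>q. q \<in> support_face Q w \<Longrightarrow> (w \<times> n) \<bullet> q \<le> (w \<times> n) \<bullet> p"
      using p unfolding G_def by (auto simp: support_face_def[of "support_face Q w"])
    obtain q where q: "q \<in> support_face Q w" "q \<noteq> p" using w by auto
    obtain c where c: "q - p = c *\<^sub>R (n \<times> w)" using diff[OF w q(1) pw] by blast
    have "(w \<times> n) \<bullet> (q - p) \<le> 0" using le[OF q(1)] by (simp add: inner_diff_right)
    then have "0 \<le> c * ((n \<times> w) \<bullet> (n \<times> w))"
      using c cross_skew[of w n] by simp
    then have "c \<ge> 0" using nw[OF w] inner_gt_zero_iff by (meson mult_neg_pos not_le)
    moreover have "c \<noteq> 0" using c q(2) by auto
    ultimately show ?thesis using q c support_face_subset by (metis less_eq_real_def subsetD)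
  qed
  have inj: "inj_on f ?S"
  proof (rule inj_onI)
    fix w w' assume w: "w \<in> ?S" and w': "w' \<in> ?S" and eq: "f w = f w'"
    define p where "p = f w"
    have p: "G w = {p}" "G w' = {p}" using f w w' eq by (simp_all add: p_def)
    obtain q c where q: "q \<in> Q" "c > 0" "q - p = c *\<^sub>R (n \<times> w)" using towards[OF w p(1)] by blast
    obtain q' c' where q': "q' \<in> Q" "c' > 0" "q' - p = c' *\<^sub>R (n \<times> w')" using towards[OF w' p(2)] by blast
    have pw: "p \<in> support_face Q w" "p \<in> support_face Q w'"
      using p support_face_subset unfolding G_def by blast+
    have "w \<bullet> q' \<le> w \<bullet> p" "w' \<bullet> q \<le> w' \<bullet> p"
      using pw q(1) q'(1) by (auto simp: support_face_def)
    then have "w \<bullet> (q' - p) \<le> 0" "w' \<bullet> (q - p) \<le> 0"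
      by (simp_all only: inner_diff_right)
    then have "w \<bullet> (n \<times> w') \<le> 0" "w' \<bullet> (n \<times> w) \<le> 0"
      unfolding q(3) q'(3) using q(2) q'(2) by (simp_all add: mult_le_0_iff)
    \<comment> \<open>By this antisymmetry the two inequalities force the product to vanish, so the
      normals are parallel.\<close>
    moreover have "w \<bullet> (n \<times> w') = - (w' \<bullet> (n \<times> w))" by (simp add: cross3_simps)
    ultimately have "w \<bullet> (n \<times> w') = 0" by linarith
    then obtain c where "w = c *\<^sub>R ((n \<times> w') \<times> n)"
      using orthogonal_both_imp_scaleR_cross[of w "n \<times> w'" n] w w' triple_cross_left[of w' n] n
      by (metis (mono_tags, lifting) mem_Collect_eq inner_eq_zero_iff norm_zero scaleR_eq_0_iff zero_neq_one)
    then have "w = (c * (n \<bullet> n)) *\<^sub>R w'" using triple_cross_left[of w' n] w' by simp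
    then have "w = w' \<or> w = - w'" using norm_eq_1_scaleR_cases w w' by blast
    \<comment> \<open>Opposite normals that both attain their maximum at \<open>p\<close> would be
      constant on \<open>Q\<close>, against \<open>nonflat\<close>.\<close>
    moreover have "w \<noteq> - w'"
    proof
      assume "w = - w'"
      then have "w \<bullet> x = w \<bullet> p" if "x \<in> Q" for x
        using that pw by (force simp: support_face_def)
      then show False using nonflat[of w] w by force
    qed
    ultimately show "w = w'" by blast
  qed
  have image: "f ` ?S = {p. p extreme_point_of Q}"
  proof (intro equalityI subsetI)
    fix p assume "p \<in> f ` ?S"
    then show "p \<in> {p. p extreme_point_of Q}" using f G_single by fastforce
  next
    fix p assume "p \<in> {p. p extreme_point_of Q}"
    then have "{p} exposed_face_of Q"
      using Q by (simp add: exposed_face_of_polyhedron face_of_singleton polytope_imp_polyhedron)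
    then obtain a b where ab: "Q \<subseteq> {x. a \<bullet> x \<le> b}" "{p} = Q \<inter> {x. a \<bullet> x = b}"
      by (auto simp: exposed_face_of_def)
    \<comment> \<open>Since \<open>n\<close> is constant on \<open>Q\<close>, the component of
      \<open>a\<close> orthogonal to \<open>n\<close> exposes \<open>p\<close> as well.\<close>
    define w0 where "w0 = a - ((a \<bullet> n) / (n \<bullet> n)) *\<^sub>R n"
    have w0n: "w0 \<bullet> n = 0" using n by (simp add: w0_def inner_diff_left)
    have pQ: "p \<in> Q" using ab by blast
    have strict: "w0 \<bullet> (q - p) < 0" if "q \<in> Q" "q \<noteq> p" for q
    proof -
      have "a \<bullet> q \<noteq> b" "a \<bullet> q \<le> b" "a \<bullet> p = b" using that ab by blast+
      then have "a \<bullet> q < a \<bullet> p" by simp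
      moreover have "n \<bullet> q = n \<bullet> p" using planar that pQ by blast
      ultimately show ?thesis by (simp add: w0_def inner_diff_left inner_diff_right)
    qed
    obtain V where V: "finite V" "Q = convex hull V" using Q by (auto simp: polytope_def)
    have "V - {p} \<noteq> {}"
    proof
      assume "V - {p} = {}"
      then have "V \<subseteq> {p}" by blast
      then have "Q \<subseteq> {p}" using V hull_mono[of V "{p}" convex] by simp
      moreover obtain i :: 3 where "n \<times> axis i 1 \<noteq> 0" using cross_basis_nonzero[OF n] by blast
      moreover have "(n \<times> axis i 1) \<bullet> n = 0" by (simp add: dot_cross_self inner_commute)
      ultimately show False using nonflat[of "n \<times> axis i 1"] by blast
    qed
    have VQ: "V \<subseteq> Q" by (simp add: V hull_subset)
    \<comment> \<open>Among the vectors \<open>z + M *\<^sub>R w0\<close>, take the least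
      \<open>M\<close> for which \<open>p\<close> is a maximiser. It is the largest slope, and there
      a second point \<open>q0\<close> of \<open>V\<close> ties with \<open>p\<close>, so
      \<open>w\<close> is normal to an edge at \<open>p\<close>.\<close>
    define z where "z = n \<times> w0"
    define slope where "slope q = (z \<bullet> (q - p)) / (w0 \<bullet> (p - q))" for q
    define M where "M = Max (slope ` (V - {p}))"
    have "M \<in> slope ` (V - {p})"
      unfolding M_def using V(1) \<open>V - {p} \<noteq> {}\<close> by (intro Max_in) simp_all
    then obtain q0 where q0: "q0 \<in> V - {p}" "slope q0 = M" by blast
    define w where "w = z + M *\<^sub>R w0"
    have w_le: "w \<bullet> (q - p) \<le> 0" if "q \<in> V" for q
    proof (cases "q = p")
      case False
      then have "slope q \<le> M" unfolding M_def using V(1) that by (intro Max_ge) auto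
      moreover have "0 < w0 \<bullet> (p - q)"
        using strict[of q] VQ that False by (auto simp: inner_diff_right)
      ultimately have "z \<bullet> (q - p) \<le> M * (w0 \<bullet> (p - q))"
        by (simp add: slope_def pos_divide_le_eq)
      then show ?thesis by (simp add: w_def inner_add_left inner_diff_right algebra_simps)
    qed simp
    have "w0 \<bullet> (q0 - p) < 0" using strict q0 VQ by blast
    then have "w0 \<bullet> (p - q0) \<noteq> 0" by (simp add: inner_diff_right)
    then have "z \<bullet> (q0 - p) = M * (w0 \<bullet> (p - q0))"
      using q0(2) by (simp add: slope_def nonzero_divide_eq_eq)
    then have w_q0: "w \<bullet> (q0 - p) = 0"
      by (simp add: w_def inner_add_left inner_diff_right algebra_simps)
    have pV: "p \<in> V" using \<open>p \<in> {p. p extreme_point_of Q}\<close> V extreme_point_of_convex_hull by blast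
    have "p \<in> support_face V w" "q0 \<in> support_face V w"
      using w_le w_q0 pV q0 by (auto simp: support_face_def inner_diff_right)
    then have supp: "p \<in> support_face Q w" "q0 \<in> support_face Q w"
      unfolding V(2) support_face_convex_hull[OF V(1)] by (auto simp: hull_inc)
    have "w0 \<noteq> 0" using \<open>w0 \<bullet> (q0 - p) < 0\<close> by auto
    then have "z \<noteq> 0" unfolding z_def using cross_nonzero_if_orthogonal w0n n by blast
    have "w \<bullet> z = z \<bullet> z" by (simp add: w_def z_def inner_add_left dot_cross_self)
    then have "w \<noteq> 0" using \<open>z \<noteq> 0\<close> by auto
    have wn: "w \<bullet> n = 0"
      using w0n dot_cross_self(1)[of n w0]
      by (simp add: w_def z_def inner_add_left inner_commute[of "n \<times> w0"])
    have wxn: "w \<times> n = (n \<bullet> n) *\<^sub>R w0 - M *\<^sub>R z"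
      using triple_cross_left[OF w0n] cross_skew[of w0 n]
      by (simp add: w_def z_def cross_add_left cross_mult_left)
    \<comment> \<open>On the face of \<open>w\<close> the values of \<open>z\<close> are determined
      by those of \<open>w0\<close>. This makes \<open>w \<times> n\<close> act as a positive
      multiple of \<open>w0\<close>, which is maximal at \<open>p\<close>: so \<open>p\<close> is
      the clockwise end.\<close>
    have zq: "z \<bullet> (q - p) = - M * (w0 \<bullet> (q - p))" if "q \<in> support_face Q w" for q
      using inner_eq_on_support_face[OF that supp(1)]
      by (simp add: w_def inner_add_left inner_diff_right algebra_simps)
    have "(w \<times> n) \<bullet> (q - p) = (n \<bullet> n + M * M) * (w0 \<bullet> (q - p))"
      if "q \<in> support_face Q w" for q
      unfolding wxn inner_diff_left inner_scaleR_left zq[OF that] by (simp add: ring_distribs)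
    moreover have "w0 \<bullet> (q - p) \<le> 0" if "q \<in> support_face Q w" for q
    proof (cases "q = p")
      case False
      then have "w0 \<bullet> (q - p) < 0" using that support_face_subset by (intro strict) blast+
      then show ?thesis by (rule less_imp_le)
    qed simp
    ultimately have "(w \<times> n) \<bullet> (q - p) \<le> 0" if "q \<in> support_face Q w" for q
      using that by (simp add: mult_le_0_iff)
    then have p_min: "p \<in> support_face (support_face Q w) (w \<times> n)"
      using supp by (simp add: support_face_def[of "support_face Q w"] inner_diff_right)
    define w1 where "w1 = (1 / norm w) *\<^sub>R w"
    have sw1: "support_face Q w1 = support_face Q w"
      unfolding w1_def using \<open>w \<noteq> 0\<close> by (intro support_face_scaleR) simp
    have "w1 \<times> n = (1 / norm w) *\<^sub>R (w \<times> n)" by (simp add: w1_def cross_mult_left)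
    then have "G w1 = support_face (support_face Q w) (w \<times> n)"
      unfolding G_def sw1 using \<open>w \<noteq> 0\<close> by (simp add: support_face_scaleR)
    then have "p \<in> G w1" using p_min by simp
    moreover have "norm w1 = 1" "w1 \<bullet> n = 0" using \<open>w \<noteq> 0\<close> wn by (simp_all add: w1_def)
    then have "w1 \<in> ?S" using supp q0(1) unfolding sw1[symmetric] by blast
    ultimately have "p = f w1" using f by blast
    then show "p \<in> f ` ?S" using \<open>w1 \<in> ?S\<close> by blast
  qed
  show ?thesis unfolding image[symmetric] by (rule card_image[OF inj])
qed

section \<open>Facets and edge directions\<close>

lemma first_nonzero_pos_uminus: "u \<noteq> 0 \<Longrightarrow> first_nonzero_pos u \<longleftrightarrow> \<not> first_nonzero_pos (- u)"
  by (auto simp: first_nonzero_pos_def vec_eq_iff forall_3)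

text \<open>Two directions of one segment are parallel unit vectors, and the sign condition picks
  one of each opposite pair. Hence edges can be grouped by direction without overlap.\<close>

lemma edge_along_unique:
  assumes "edge_along E u" "edge_along E v" "norm u = 1" "norm v = 1"
    "first_nonzero_pos u" "first_nonzero_pos v"
  shows "u = v"
proof -
  obtain x y where xy: "x \<in> E" "y \<in> E" "x \<noteq> y" using assms(1) by (auto simp: edge_along_def)
  obtain c where c: "x - y = c *\<^sub>R u" using assms(1) xy by (auto simp: edge_along_def)
  obtain d where d: "x - y = d *\<^sub>R v" using assms(2) xy by (auto simp: edge_along_def)
  have "c \<noteq> 0" using c xy by auto
  then have "u = (d / c) *\<^sub>R v"
    using arg_cong[OF c[unfolded d], of "\<lambda>v. inverse c *\<^sub>R v"] by (simp add: divide_inverse mult.commute)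
  then have "u = v \<or> u = - v" using norm_eq_1_scaleR_cases assms by blast
  moreover have "u \<noteq> - v" using assms first_nonzero_pos_uminus[of v] by force
  ultimately show ?thesis by blast
qed

lemma edge_along_exists:
  assumes "collinear E" "x \<in> E" "y \<in> E" "x \<noteq> y"
  obtains v where "norm v = 1" "first_nonzero_pos v" "edge_along E v"
proof -
  define v where "v = (1 / norm (x - y)) *\<^sub>R (x - y)"
  have nv: "norm v = 1" using assms by (simp add: v_def)
  have xy: "x - y = norm (x - y) *\<^sub>R v" using assms by (simp add: v_def)
  then have "edge_along E v" "edge_along E (- v)"
    using edge_along_if_collinear[OF assms] edge_along_if_collinear[OF assms, of "- norm (x - y)" "- v"]
    by auto
  moreover have "first_nonzero_pos v \<or> first_nonzero_pos (- v)"
    using first_nonzero_pos_uminus[of v] nv by force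
  ultimately show thesis using that[of v] that[of "- v"] nv by auto
qed

section \<open>Facet normals of a three-dimensional polytope\<close>

locale polytope3 =
  fixes P :: "(real^3) set"
  assumes polytope_P: "polytope P" and aff_dim_P: "aff_dim P = 3"
begin

lemma convex_P: "convex P" and compact_P: "compact P" and polyhedron_P: "polyhedron P"
  using polytope_P
  by (simp_all add: polytope_imp_convex polytope_imp_compact polytope_imp_polyhedron)

lemma P_nonempty: "P \<noteq> {}"
  using aff_dim_P by auto

lemma not_flat:
  assumes "w \<noteq> 0" obtains x y where "x \<in> P" "y \<in> P" "w \<bullet> x \<noteq> w \<bullet> y"
proof -
  have "\<not> (\<forall>x\<in>P. \<forall>y\<in>P. w \<bullet> x = w \<bullet> y)"
  proof
    assume *: "\<forall>x\<in>P. \<forall>y\<in>P. w \<bullet> x = w \<bullet> y"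
    obtain x where "x \<in> P" using P_nonempty by blast
    with * have "P \<subseteq> {y. w \<bullet> y = w \<bullet> x}" by blast
    from aff_dim_subset[OF this] show False
      using assms aff_dim_P by (simp add: aff_dim_hyperplane)
  qed
  then show thesis using that by blast
qed

lemma nonempty_support_face: "support_face P w \<noteq> {}"
  using support_face_nonempty compact_P P_nonempty by blast

lemma polytope_support_face: "polytope (support_face P w)"
  using support_face_face_of polytope_P convex_P face_of_polytope_polytope by blast

lemma support_face_facet:
  assumes "w \<noteq> 0" "\<not> collinear (support_face P w)"
  shows "support_face P w facet_of P"
proof -
  obtain x where x: "x \<in> support_face P w" using nonempty_support_face by blast
  have "aff_dim (support_face P w) \<le> aff_dim {y. w \<bullet> y = w \<bullet> x}"
    unfolding support_face_eq_Int_hyperplane[OF x] by (intro aff_dim_subset) auto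
  then have "aff_dim (support_face P w) \<le> 2" using assms(1) by (simp add: aff_dim_hyperplane)
  then have "aff_dim (support_face P w) = 2" using assms(2) by (simp add: collinear_aff_dim)
  then show ?thesis
    using x by (auto simp: facet_of_def aff_dim_P support_face_face_of convex_P)
qed

lemma exposed_support_face:
  assumes "P \<subseteq> {x. a \<bullet> x \<le> b}" "F = P \<inter> {x. a \<bullet> x = b}" "F \<noteq> {}"
  shows "F = support_face P a"
proof -
  obtain x where "x \<in> F" using assms(3) by blast
  then have "x \<in> support_face P a" "a \<bullet> x = b" using assms by (auto simp: support_face_def)
  then show ?thesis using support_face_eq_Int_hyperplane assms(2) by metis
qed

lemma facet_is_support_face:
  assumes "F facet_of P"
  obtains a where "norm a = 1" "F = support_face P a" "\<not> collinear F"
proof -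
  obtain a b where ab: "a \<noteq> 0" "P \<subseteq> {x. a \<bullet> x \<le> b}" "F = P \<inter> {x. a \<bullet> x = b}"
    using facet_of_polyhedron polyhedron_P assms by blast
  have F: "aff_dim F = 2" "F \<noteq> {}" using assms by (auto simp: facet_of_def aff_dim_P)
  show thesis
  proof
    show "norm ((1 / norm a) *\<^sub>R a) = 1" using ab by simp
    show "F = support_face P ((1 / norm a) *\<^sub>R a)"
      using exposed_support_face[OF ab(2,3) F(2)] ab(1) by (simp add: support_face_scaleR)
    show "\<not> collinear F" using F by (simp add: collinear_aff_dim)
  qed
qed

text \<open>The differences of points of the facet span a subspace of the plane orthogonal to
  \<open>a\<close>; its dimension is at least 2, so it is the whole plane.\<close>

lemma plane_orth_support_face_iff:
  assumes "a \<noteq> 0" "\<not> collinear (support_face P a)"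
  shows "plane_orth_facet n (support_face P a) \<longleftrightarrow> n \<bullet> a = 0"
proof -
  let ?F = "support_face P a" and ?D = "{x - y | x y. x \<in> support_face P a \<and> y \<in> support_face P a}"
  have "?D \<subseteq> {x. a \<bullet> x = 0}"
    using inner_eq_on_support_face by (auto simp: inner_diff_right)
  then have sub: "span ?D \<subseteq> {x. a \<bullet> x = 0}"
    by (simp add: span_minimal subspace_hyperplane)
  obtain x where x: "x \<in> ?F" using nonempty_support_face by blast
  have "2 \<le> aff_dim ?F" using assms(2) by (simp add: collinear_aff_dim)
  also have "aff_dim ?F = int (dim ((\<lambda>y. y - x) ` ?F))"
    by (rule aff_dim_eq_dim_subtract) (simp add: x hull_inc)
  also have "\<dots> \<le> int (dim (span ?D))"
    using x by (simp only: of_nat_le_iff, intro dim_subset) (auto intro!: span_base)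
  finally have "dim {x. a \<bullet> x = 0} \<le> dim (span ?D)" using assms(1) by (simp add: dim_hyperplane)
  then have "span ?D = {x. a \<bullet> x = 0}"
    using subspace_dim_equal[OF subspace_span subspace_hyperplane sub] by simp
  then show ?thesis by (simp add: plane_orth_facet_def inner_commute)
qed

text \<open>The outer unit normals of the facets: in a nonzero direction, a support face has
  dimension 2 exactly when it is not collinear.\<close>

definition facet_normals :: "(real^3) set" where
  "facet_normals = {a. norm a = 1 \<and> \<not> collinear (support_face P a)}"

text \<open>There are finitely many faces, and a facet determines its normal: non-parallel normals
  can share only a collinear face, and opposite ones would flatten \<open>P\<close>.\<close>

lemma finite_facet_normals: "finite facet_normals"
proof (rule inj_on_finite)
  show "inj_on (support_face P) facet_normals"
  proof (rule inj_onI)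
    fix a b assume a: "a \<in> facet_normals" and b: "b \<in> facet_normals"
      and eq: "support_face P a = support_face P b"
    have "a \<times> b = 0"
    proof (rule ccontr)
      assume "a \<times> b \<noteq> 0"
      then have "collinear (support_face (support_face P a) b)"
        by (rule collinear_support_face_support_face)
      moreover have "support_face (support_face P a) b = support_face P a"
        by (intro support_face_eq_self, rule inner_eq_on_support_face[of _ P b]) (simp_all add: eq)
      ultimately show False using a by (simp add: facet_normals_def)
    qed
    moreover have "a \<noteq> 0" using a by (auto simp: facet_normals_def)
    ultimately obtain c where "b = c *\<^sub>R a" using cross_eq_0_imp_scaleR by blast
    then have "b = a \<or> b = - a"
      using norm_eq_1_scaleR_cases a b unfolding facet_normals_def by blast
    moreover have "b \<noteq> - a"
    proof
      assume b: "b = - a"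
      obtain x where x: "x \<in> support_face P a" using nonempty_support_face by blast
      have "a \<bullet> y = a \<bullet> x" if "y \<in> P" for y
        using x x[unfolded eq b] that by (force simp: support_face_def)
      then show False using not_flat[OF \<open>a \<noteq> 0\<close>] by metis
    qed
    ultimately show "a = b" by blast
  qed
  show "support_face P ` facet_normals \<subseteq> {F. F face_of P}"
    using support_face_face_of convex_P by blast
  show "finite {F. F face_of P}" using finite_polytope_faces polytope_P by blast
qed

lemma not_collinear_support_face:
  assumes "w \<noteq> 0" "\<not> collinear (support_face P w)"
  shows "(1 / norm w) *\<^sub>R w \<in> facet_normals"
  using assms by (simp add: facet_normals_def support_face_scaleR)

text \<open>The condition on projection directions, turned into finitely many inequations.\<close>

definition generic :: "real^3 \<Rightarrow> bool" where
  "generic n \<longleftrightarrow> (\<forall>a\<in>facet_normals. n \<bullet> a \<noteq> 0)"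

lemma generic_iff: "generic n \<longleftrightarrow> (\<forall>F. F facet_of P \<longrightarrow> \<not> plane_orth_facet n F)"
proof
  assume g: "generic n"
  show "\<forall>F. F facet_of P \<longrightarrow> \<not> plane_orth_facet n F"
  proof (intro allI impI)
    fix F assume "F facet_of P"
    then obtain a where a: "norm a = 1" "F = support_face P a" "\<not> collinear F"
      using facet_is_support_face by blast
    then have "n \<bullet> a \<noteq> 0" using g by (auto simp: generic_def facet_normals_def)
    moreover have "a \<noteq> 0" using a(1) by auto
    ultimately show "\<not> plane_orth_facet n F" using a plane_orth_support_face_iff by blast
  qed
next
  assume *: "\<forall>F. F facet_of P \<longrightarrow> \<not> plane_orth_facet n F"
  show "generic n"
    unfolding generic_def
  proof
    fix a assume "a \<in> facet_normals"
    then have "a \<noteq> 0" "\<not> collinear (support_face P a)" by (auto simp: facet_normals_def)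
    then show "n \<bullet> a \<noteq> 0" using * support_face_facet plane_orth_support_face_iff by blast
  qed
qed

lemma generic_collinear:
  assumes "generic n" "w \<noteq> 0" "w \<bullet> n = 0"
  shows "collinear (support_face P w)"
  using assms not_collinear_support_face[of w] by (force simp: generic_def inner_commute)

text \<open>A proper face lies in a facet, whose normal annihilates all chords of the face.\<close>

lemma support_face_orthogonal_facet_normal:
  assumes "w \<noteq> 0" obtains a where "a \<in> facet_normals"
    "\<And>x y. x \<in> support_face P w \<Longrightarrow> y \<in> support_face P w \<Longrightarrow> (x - y) \<bullet> a = 0"
proof -
  have "support_face P w \<noteq> P"
    using not_flat[OF assms] inner_eq_on_support_face by metis
  then obtain F where F: "F facet_of P" "support_face P w \<subseteq> F"
    using face_of_polyhedron_subset_facet[OF polyhedron_P] support_face_face_of[OF convex_P]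
      nonempty_support_face by metis
  obtain a where a: "norm a = 1" "F = support_face P a" "\<not> collinear F"
    using facet_is_support_face F(1) by blast
  show thesis
  proof
    show "a \<in> facet_normals" using a by (simp add: facet_normals_def)
    fix x y assume "x \<in> support_face P w" "y \<in> support_face P w"
    then have "a \<bullet> x = a \<bullet> y" using F(2) a(2) inner_eq_on_support_face by blast
    then show "(x - y) \<bullet> a = 0" by (metis inner_commute inner_diff_right right_minus_eq)
  qed
qed

text \<open>Faces of a polyhedron are exposed, so an edge is the support face of some
  \<open>w\<close>. Conversely, a support segment is the hull of its extreme points and therefore
  has two of them.\<close>

lemma edge_direction_iff:
  "edge_direction P u \<longleftrightarrow> norm u = 1 \<and> first_nonzero_pos u \<and> (\<exists>w. w \<noteq> 0 \<and> edge_along (support_face P w) u)"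
proof -
  have "\<exists>w. w \<noteq> 0 \<and> edge_along (support_face P w) u"
    if E: "E face_of P" "aff_dim E = 1" "x extreme_point_of E" "y extreme_point_of E" "x \<noteq> y" "x - y = c *\<^sub>R u"
    for E x y c
  proof -
    have "E \<noteq> {}" "E \<noteq> P" using E(2) aff_dim_P by auto
    moreover have "E exposed_face_of P" using E(1) polyhedron_P exposed_face_of_polyhedron by blast
    ultimately obtain a b where ab: "a \<noteq> 0" "P \<subseteq> {x. a \<bullet> x \<le> b}" "E = P \<inter> {x. a \<bullet> x = b}"
      by (auto simp: exposed_face_of)
    have "E = support_face P a" using exposed_support_face ab(2,3) \<open>E \<noteq> {}\<close> by blast
    moreover have "edge_along E u"
      by (rule edge_along_if_collinear[OF _ _ _ E(5,6)])
        (use E in \<open>auto simp: collinear_aff_dim extreme_point_of_def\<close>)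
    ultimately show ?thesis using ab(1) by blast
  qed
  moreover have "\<exists>E x y c. E face_of P \<and> aff_dim E = 1 \<and> x extreme_point_of E \<and> y extreme_point_of E \<and>
        x \<noteq> y \<and> x - y = c *\<^sub>R u" if w: "edge_along (support_face P w) u" for w
  proof -
    let ?E = "support_face P w"
    have E: "?E = convex hull {x. x extreme_point_of ?E}"
      using polytope_support_face Krein_Milman_Minkowski polytope_imp_compact polytope_imp_convex by blast
    have two: "\<exists>x\<in>?E. \<exists>y\<in>?E. x \<noteq> y" using w by (auto simp: edge_along_def)
    have "\<not> {x. x extreme_point_of ?E} \<subseteq> {p}" for p
    proof
      assume "{x. x extreme_point_of ?E} \<subseteq> {p}"
      then have "convex hull {x. x extreme_point_of ?E} \<subseteq> {p}"
        by (rule hull_minimal) simp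
      then show False using two E by blast
    qed
    then obtain x y where xy: "x extreme_point_of ?E" "y extreme_point_of ?E" "x \<noteq> y" by blast
    then obtain c where "x - y = c *\<^sub>R u"
      using w unfolding edge_along_def extreme_point_of_def by blast
    moreover have "aff_dim ?E = 1"
    proof -
      have "aff_dim ?E \<le> 1" using edge_along_imp_collinear[OF w] by (simp add: collinear_aff_dim)
      moreover have "aff_dim ?E \<noteq> 0" using two by (auto simp: aff_dim_eq_0)
      moreover have "aff_dim ?E \<ge> 0"
        using nonempty_support_face aff_dim_empty[of ?E] aff_dim_geq[of ?E] by force
      ultimately show ?thesis by linarith
    qed
    ultimately show ?thesis using xy support_face_face_of[OF convex_P] by blast
  qed
  ultimately show ?thesis unfolding edge_direction_def by blast
qed

text \<open>Choosing for each direction one edge parallel to it gives an injection into the finite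
  set of faces.\<close>

lemma finite_edge_directions: "finite {u. edge_direction P u}"
proof -
  obtain N where N: "\<And>u. edge_direction P u \<Longrightarrow> edge_along (support_face P (N u)) u"
    using edge_direction_iff by metis
  show ?thesis
  proof (rule inj_on_finite)
    show "inj_on (\<lambda>u. support_face P (N u)) {u. edge_direction P u}"
    proof (rule inj_onI)
      fix u v assume "u \<in> {u. edge_direction P u}" "v \<in> {u. edge_direction P u}"
        "support_face P (N u) = support_face P (N v)"
      then show "u = v"
        using N[of u] N[of v] edge_along_unique edge_direction_iff by (metis mem_Collect_eq)
    qed
    show "(\<lambda>u. support_face P (N u)) ` {u. edge_direction P u} \<subseteq> {F. F face_of P}"
      using support_face_face_of convex_P by blast
    show "finite {F. F face_of P}" using finite_polytope_faces polytope_P by blast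
  qed
qed

lemma edge_direction_facet_normal:
  assumes "edge_direction P v" obtains a where "a \<in> facet_normals" "v \<bullet> a = 0"
proof -
  obtain w where w: "w \<noteq> 0" "edge_along (support_face P w) v"
    using assms edge_direction_iff by blast
  obtain a where a: "a \<in> facet_normals"
    "\<And>x y. x \<in> support_face P w \<Longrightarrow> y \<in> support_face P w \<Longrightarrow> (x - y) \<bullet> a = 0"
    using support_face_orthogonal_facet_normal w(1) by blast
  obtain x y where xy: "x \<in> support_face P w" "y \<in> support_face P w" "x \<noteq> y"
    using w(2) by (auto simp: edge_along_def)
  obtain c where c: "x - y = c *\<^sub>R v" using xy w(2) by (auto simp: edge_along_def)
  then have "c \<noteq> 0" using xy by auto
  moreover have "c * (v \<bullet> a) = 0" using a(2)[OF xy(1,2)] c by simp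
  ultimately show thesis using that a(1) by simp
qed

text \<open>Every edge lies in a facet, and a generic \<open>n\<close> is parallel to no
  facet.\<close>

lemma generic_cross_edge_direction:
  assumes "generic n" "n \<noteq> 0" "edge_direction P v" shows "n \<times> v \<noteq> 0"
proof
  assume "n \<times> v = 0"
  then obtain c where c: "v = c *\<^sub>R n" using cross_eq_0_imp_scaleR assms(2) by blast
  moreover obtain a where a: "a \<in> facet_normals" "v \<bullet> a = 0"
    using edge_direction_facet_normal assms(3) by blast
  moreover have "v \<noteq> 0" using assms(3) by (auto simp: edge_direction_def)
  ultimately have "n \<bullet> a = 0" by auto
  then show False using assms(1) a(1) by (simp add: generic_def)
qed

section \<open>The vertices of a projection\<close>

text \<open>\<open>hits v w\<close> counts the rays of the line spanned by \<open>w\<close> that lie in the relative interior of the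
  normal cone of some edge parallel to \<open>v\<close>.\<close>

definition hits :: "real^3 \<Rightarrow> real^3 \<Rightarrow> int" where
  "hits v w = of_bool (edge_along (support_face P w) v) + of_bool (edge_along (support_face P (- w)) v)"

lemma linear_proj_plane: "linear (proj_plane n)"
  by (rule linearI) (simp_all add: proj_plane_def inner_add_left add_divide_distrib algebra_simps)

lemma inner_proj_plane: "w \<bullet> n = 0 \<Longrightarrow> w \<bullet> proj_plane n x = w \<bullet> x"
  by (simp add: proj_plane_def inner_diff_right)

lemma support_face_proj_plane:
  "w \<bullet> n = 0 \<Longrightarrow> support_face (proj_plane n ` P) w = proj_plane n ` support_face P w"
  by (auto simp: support_face_def inner_proj_plane)

lemma unit_normal_of_edge:
  assumes "n \<times> v \<noteq> 0" "norm w = 1" "w \<bullet> n = 0" "edge_along (support_face P w) v"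
  shows "w = sgn (n \<times> v) \<or> w = - sgn (n \<times> v)"
proof -
  have "w \<bullet> v = 0" using assms(4) edge_along_support_face_orthogonal by blast
  then obtain c where "w = c *\<^sub>R (n \<times> v)"
    using orthogonal_both_imp_scaleR_cross assms(1,3) by blast
  then have "w = (c * norm (n \<times> v)) *\<^sub>R sgn (n \<times> v)" using assms(1) by (simp add: sgn_div_norm)
  moreover have "norm (sgn (n \<times> v)) = 1" using assms(1) by (simp add: norm_sgn)
  ultimately show ?thesis using norm_eq_1_scaleR_cases assms(2) by blast
qed

text \<open>A normal that is orthogonal to \<open>n\<close> and supports an edge along
  \<open>v\<close> lies on the line of \<open>n \<times> v\<close>; the only candidates are the two
  unit vectors there.\<close>

lemma card_unit_normals:
  assumes "n \<times> v \<noteq> 0"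
  shows "finite {w. norm w = 1 \<and> w \<bullet> n = 0 \<and> edge_along (support_face P w) v}" (is "finite ?T")
    and "int (card {w. norm w = 1 \<and> w \<bullet> n = 0 \<and> edge_along (support_face P w) v}) = hits v (n \<times> v)"
proof -
  define m where "m = sgn (n \<times> v)"
  have m: "norm m = 1" using assms by (simp add: m_def norm_sgn)
  then have m0: "m \<noteq> - m" by (auto simp: eq_neg_iff_add_eq_0 simp flip: scaleR_2)
  have mn: "m \<bullet> n = 0" by (simp add: m_def sgn_div_norm dot_cross_self inner_commute)
  have sf: "support_face P m = support_face P (n \<times> v)" "support_face P (- m) = support_face P (- (n \<times> v))"
    using support_face_scaleR[of "inverse (norm (n \<times> v))" P] assms
    by (simp_all add: m_def sgn_div_norm flip: scaleR_minus_right)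
  have T: "?T = (if edge_along (support_face P m) v then {m} else {}) \<union>
      (if edge_along (support_face P (- m)) v then {- m} else {})"
    using m mn unit_normal_of_edge[OF assms] by (auto simp: m_def split: if_splits)
  show "finite ?T" unfolding T by simp
  show "int (card ?T) = hits v (n \<times> v)" unfolding T using m0 by (simp add: hits_def sf)
qed

text \<open>The polygon count turns vertices of the projection into unit normals of its edges. These
  are the normals orthogonal to \<open>n\<close> of edges of \<open>P\<close>, and they are sorted
  by edge direction.\<close>

lemma card_extreme_points_projection:
  assumes "generic n" "n \<noteq> 0"
  shows "int (card {p. p extreme_point_of (proj_plane n ` P)}) =
    (\<Sum>v\<in>{v. edge_direction P v}. hits v (n \<times> v))"
proof -
  let ?Q = "proj_plane n ` P"
  let ?S = "{w. norm w = 1 \<and> w \<bullet> n = 0 \<and> (\<exists>x\<in>support_face P w. \<exists>y\<in>support_face P w. x \<noteq> y)}"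
  let ?T = "\<lambda>v. {w. norm w = 1 \<and> w \<bullet> n = 0 \<and> edge_along (support_face P w) v}"
  \<comment> \<open>No edge collapses: its chords are orthogonal to a facet normal, while
    \<open>n\<close> is not.\<close>
  have inj: "proj_plane n x \<noteq> proj_plane n y"
    if w: "norm w = 1" and x: "x \<in> support_face P w" and y: "y \<in> support_face P w" and "x \<noteq> y" for w x y
  proof
    assume "proj_plane n x = proj_plane n y"
    then have "x - y = ((x \<bullet> n) / (n \<bullet> n) - (y \<bullet> n) / (n \<bullet> n)) *\<^sub>R n"
      by (simp add: proj_plane_def algebra_simps)
    then obtain c where c: "x - y = c *\<^sub>R n" by blast
    have "w \<noteq> 0" using w by auto
    then obtain a where a: "a \<in> facet_normals" "(x - y) \<bullet> a = 0"
      using support_face_orthogonal_facet_normal x y by metis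
    then have "c = 0" using c assms(1) by (auto simp: generic_def)
    then show False using c \<open>x \<noteq> y\<close> by simp
  qed
  have "card {p. p extreme_point_of ?Q} =
    card {w. norm w = 1 \<and> w \<bullet> n = 0 \<and> (\<exists>x\<in>support_face ?Q w. \<exists>y\<in>support_face ?Q w. x \<noteq> y)}"
  proof (rule card_extreme_points_polygon)
    show "polytope ?Q" using polytope_linear_image linear_proj_plane polytope_P by blast
    show "n \<bullet> x = n \<bullet> y" if "x \<in> ?Q" "y \<in> ?Q" for x y
    proof -
      have "n \<bullet> proj_plane n p = 0" for p
        using assms(2) by (simp add: proj_plane_def inner_diff_right inner_commute)
      then show ?thesis using that by auto
    qed
    show "\<exists>x\<in>?Q. \<exists>y\<in>?Q. w \<bullet> x \<noteq> w \<bullet> y" if "w \<noteq> 0" "w \<bullet> n = 0" for w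
      using not_flat[OF that(1)] that(2) by (metis imageI inner_proj_plane)
  qed (rule assms(2))
  also have "{w. norm w = 1 \<and> w \<bullet> n = 0 \<and> (\<exists>x\<in>support_face ?Q w. \<exists>y\<in>support_face ?Q w. x \<noteq> y)} = ?S"
    using inj by (auto simp: support_face_proj_plane) metis+
  also have "?S = (\<Union>v\<in>{v. edge_direction P v}. ?T v)"
  proof (intro equalityI subsetI)
    fix w assume w: "w \<in> ?S"
    then have "w \<noteq> 0" by auto
    then have "collinear (support_face P w)" using w assms(1) generic_collinear by blast
    then obtain v where v: "norm v = 1" "first_nonzero_pos v" "edge_along (support_face P w) v"
      using w edge_along_exists by (smt (verit) mem_Collect_eq)
    then have "edge_direction P v" using \<open>w \<noteq> 0\<close> edge_direction_iff by blast
    then show "w \<in> (\<Union>v\<in>{v. edge_direction P v}. ?T v)" using w v by blast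
  next
    fix w assume "w \<in> (\<Union>v\<in>{v. edge_direction P v}. ?T v)"
    then show "w \<in> ?S" by (auto simp: edge_along_def)
  qed
  also have "card \<dots> = (\<Sum>v\<in>{v. edge_direction P v}. card (?T v))"
  proof (rule card_UN_disjoint)
    show "finite {v. edge_direction P v}" by (rule finite_edge_directions)
    show "\<forall>v\<in>{v. edge_direction P v}. finite (?T v)"
      using card_unit_normals(1) generic_cross_edge_direction assms by blast
    show "\<forall>u\<in>{v. edge_direction P v}. \<forall>v\<in>{v. edge_direction P v}. u \<noteq> v \<longrightarrow> ?T u \<inter> ?T v = {}"
      using edge_along_unique by (force simp: edge_direction_def)
  qed
  finally have "int (card {p. p extreme_point_of ?Q}) = (\<Sum>v\<in>{v. edge_direction P v}. int (card (?T v)))"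
    by simp
  also have "\<dots> = (\<Sum>v\<in>{v. edge_direction P v}. hits v (n \<times> v))"
    using card_unit_normals(2) generic_cross_edge_direction assms by (intro sum.cong) auto
  finally show ?thesis .
qed

section \<open>Constancy of the summands\<close>

lemma hits_uminus: "hits v (- w) = hits v w"
  by (simp add: hits_def)

lemma hits_scaleR: "c \<noteq> 0 \<Longrightarrow> hits v (c *\<^sub>R w) = hits v w"
proof -
  have pos: "hits v (c *\<^sub>R w) = hits v w" if "c > 0" for c w
    using support_face_scaleR[OF that, of P w] support_face_scaleR[OF that, of P "- w"]
    by (simp add: hits_def)
  assume "c \<noteq> 0"
  then show ?thesis using pos[of c w] pos[of "- c" "- w"] by (cases "c > 0") (auto simp: hits_uminus)
qed

text \<open>The value of \<open>hits v\<close> immediately after leaving \<open>w\<close> in direction \<open>z\<close>.\<close>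

definition hits_near :: "real^3 \<Rightarrow> real^3 \<Rightarrow> real^3 \<Rightarrow> int" where
  "hits_near v w z = of_bool (edge_along (support_face (support_face P w) z) v) +
     of_bool (edge_along (support_face (support_face P (- w)) (- z)) v)"

lemma eventually_hits: "\<forall>\<^sub>F s in at_right 0. hits v (w + s *\<^sub>R z) = hits_near v w z"
  using eventually_support_face_perturb[OF polytope_P, of w z]
    eventually_support_face_perturb[OF polytope_P, of "- w" "- z"]
proof eventually_elim
  case (elim s)
  have "- (w + s *\<^sub>R z) = - w + s *\<^sub>R - z" by simp
  then show ?case using elim unfolding hits_def hits_near_def by presburger
qed

lemma hits_near_uminus: "hits_near v (- w) z = hits_near v w (- z)"
  by (simp add: hits_near_def)

text \<open>Reversing \<open>z\<close> merely swaps the two summands. This settles the degenerate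
  jumps with \<open>n \<times> v = 0\<close>.\<close>

lemma hits_near_0: "hits_near v 0 (- z) = hits_near v 0 z"
  by (simp add: hits_near_def)

lemma hits_near_scaleR:
  assumes "0 < c" shows "hits_near v (c *\<^sub>R w) z = hits_near v w z"
  using support_face_scaleR[OF assms, of P w] support_face_scaleR[OF assms, of P "- w"]
  by (simp add: hits_near_def)

lemma hits_near_combination:
  assumes "0 < b" shows "hits_near v w (a *\<^sub>R w + b *\<^sub>R z) = hits_near v w z"
proof -
  have "- (a *\<^sub>R w + b *\<^sub>R z) = a *\<^sub>R (- w) + b *\<^sub>R (- z)" by simp
  then show ?thesis
    using support_face_support_face_combination[OF assms] unfolding hits_near_def by metis
qed

text \<open>Passing to the \<open>z\<close>-face of a collinear face neither creates nor destroys a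
  segment along \<open>v\<close> when \<open>z\<close> is orthogonal to \<open>v\<close>; so within
  the plane orthogonal to \<open>v\<close> the count can jump only at facet normals and their
  negatives.\<close>

lemma hits_near_collinear:
  assumes "collinear (support_face P w)" "collinear (support_face P (- w))" "z \<bullet> v = 0"
  shows "hits_near v w z = hits v w"
  using assms by (simp add: hits_near_def hits_def edge_along_support_face_collinear)

lemma eventually_collinear:
  assumes "w \<times> z \<noteq> 0"
  shows "\<forall>\<^sub>F s in at_right 0. collinear (support_face P (w + s *\<^sub>R z)) \<and>
    collinear (support_face P (- (w + s *\<^sub>R z)))"
  using eventually_support_face_perturb[OF polytope_P, of w z]
    eventually_support_face_perturb[OF polytope_P, of "- w" "- z"]
proof eventually_elim
  case (elim s)
  have "- (w + s *\<^sub>R z) = - w + s *\<^sub>R - z" by simp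
  then show ?case using elim collinear_support_face_support_face[of w z P]
      collinear_support_face_support_face[of "- w" "- z" P] assms by simp
qed

end

text \<open>By the count of projected vertices, equiprojectivity amounts to the assumption \<open>sum_hits\<close>.\<close>

locale equiprojective3 = polytope3 +
  fixes k :: int
  assumes sum_hits: "\<And>n. n \<noteq> 0 \<Longrightarrow> generic n \<Longrightarrow> (\<Sum>v\<in>{v. edge_direction P v}. hits v (n \<times> v)) = k"
begin

text \<open>The change of the \<open>v\<close>-summand when the projection direction crosses \<open>n\<close> along \<open>w\<close>.\<close>

definition jump :: "real^3 \<Rightarrow> real^3 \<Rightarrow> real^3 \<Rightarrow> int" where
  "jump w n v = hits_near v (n \<times> v) (w \<times> v) - hits_near v (n \<times> v) (- (w \<times> v))"

text \<open>Close to \<open>n\<close> on either side along \<open>w\<close> the directions are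
  generic, so both one-sided sums equal \<open>k\<close>. By \<open>gen\<close>, the vector
  \<open>n\<close> can be orthogonal only to facet normals parallel to \<open>w\<close>.\<close>

lemma sum_jump:
  assumes "n \<noteq> 0" "n \<bullet> w = 0" "w \<noteq> 0"
    and gen: "\<And>a. a \<in> facet_normals \<Longrightarrow> a \<times> w \<noteq> 0 \<Longrightarrow> n \<bullet> a \<noteq> 0"
  shows "(\<Sum>v\<in>{v. edge_direction P v}. jump w n v) = 0"
proof -
  let ?V = "{v. edge_direction P v}"
  have one_sided: "(\<Sum>v\<in>?V. hits_near v (n \<times> v) (z \<times> v)) = k" if z: "z = w \<or> z = - w" for z
  proof -
    have "\<forall>\<^sub>F s in at_right 0. \<forall>v\<in>?V. hits v (n \<times> v + s *\<^sub>R (z \<times> v)) = hits_near v (n \<times> v) (z \<times> v)"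
      by (intro eventually_ball_finite ballI eventually_hits finite_edge_directions)
    moreover have "\<forall>\<^sub>F s in at 0. \<forall>a\<in>facet_normals. n \<bullet> a + s * (z \<bullet> a) \<noteq> 0"
    proof (intro eventually_ball_finite ballI eventually_affine_nonzero finite_facet_normals)
      fix a assume a: "a \<in> facet_normals"
      \<comment> \<open>The displacement along \<open>z\<close> takes care of the normals parallel
        to \<open>w\<close>, and \<open>n\<close> itself of the others.\<close>
      show "n \<bullet> a \<noteq> 0 \<or> z \<bullet> a \<noteq> 0"
      proof (cases "a \<times> w = 0")
        case True
        have "a \<noteq> 0" using a by (auto simp: facet_normals_def)
        then have "a \<bullet> w \<noteq> 0" using True assms(3) norm_and_cross_eq_0[of a w] by blast
        then show ?thesis using z by (auto simp: inner_commute)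
      qed (use gen a in blast)
    qed
    then have "\<forall>\<^sub>F s in at_right 0. \<forall>a\<in>facet_normals. n \<bullet> a + s * (z \<bullet> a) \<noteq> 0"
      by (rule filter_leD[OF at_le, rotated]) simp
    ultimately have "\<forall>\<^sub>F s in at_right (0::real). (\<Sum>v\<in>?V. hits_near v (n \<times> v) (z \<times> v)) = k"
    proof eventually_elim
      case (elim s)
      have "(n + s *\<^sub>R z) \<bullet> n = n \<bullet> n"
        using z assms(2) by (auto simp: inner_add_left inner_diff_left inner_commute[of w])
      then have "n + s *\<^sub>R z \<noteq> 0" using assms(1) by auto
      moreover have "generic (n + s *\<^sub>R z)" using elim(2) by (simp add: generic_def inner_add_left)
      ultimately have "(\<Sum>v\<in>?V. hits v ((n + s *\<^sub>R z) \<times> v)) = k" by (rule sum_hits)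
      then show ?case using elim(1) by (simp add: cross_add_left cross_mult_left)
    qed
    then show ?thesis by simp
  qed
  show ?thesis
    using one_sided[of w] one_sided[of "- w"] by (simp add: jump_def sum_subtractf)
qed

text \<open>A facet normal along \<open>n \<times> v\<close> would be orthogonal to
  \<open>n\<close>, hence parallel to \<open>w\<close>; but it is orthogonal to \<open>v\<close>,
  and \<open>w\<close> is not. So only directions parallel to the crossed facet plane can
  jump.\<close>

lemma jump_eq_0:
  assumes "n \<bullet> w = 0" "w \<noteq> 0" "w \<bullet> v \<noteq> 0"
    and gen: "\<And>a. a \<in> facet_normals \<Longrightarrow> a \<times> w \<noteq> 0 \<Longrightarrow> n \<bullet> a \<noteq> 0"
  shows "jump w n v = 0"
proof (cases "n \<times> v = 0")
  case True
  then show ?thesis by (simp add: jump_def hits_near_0)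
next
  case False
  have "collinear (support_face P x)" if x: "x = n \<times> v \<or> x = - (n \<times> v)" for x
  proof (rule ccontr)
    assume "\<not> collinear (support_face P x)"
    moreover have "x \<noteq> 0" using x False by auto
    ultimately have a: "(1 / norm x) *\<^sub>R x \<in> facet_normals" by (simp add: not_collinear_support_face)
    have "n \<bullet> x = 0" using x by (auto simp: dot_cross_self)
    then have "((1 / norm x) *\<^sub>R x) \<times> w = 0" using gen[OF a] by auto
    then have "x \<times> w = 0" using \<open>x \<noteq> 0\<close> by (simp add: cross_mult_left)
    then obtain c where "w = c *\<^sub>R x" using cross_eq_0_imp_scaleR \<open>x \<noteq> 0\<close> by blast
    moreover have "x \<bullet> v = 0" using x by (auto simp: dot_cross_self)
    ultimately show False using assms(3) by simp
  qed
  then show ?thesis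
    by (simp add: jump_def hits_near_collinear dot_cross_self)
qed

text \<open>Take projection directions near \<open>u + e *\<^sub>R d\<close> with \<open>d = w \<times> u\<close>. Replacing \<open>e\<close> by \<open>- e\<close>
  reverses the sign of the jump of the \<open>u\<close>-summand and leaves all other jumps unchanged, while the
  jumps always add up to zero.\<close>

lemma hits_near_symmetric_cross:
  assumes u: "edge_direction P u" and w: "w \<noteq> 0" "w \<bullet> u = 0"
  shows "hits_near u w (w \<times> u) = hits_near u w (- (w \<times> u))"
proof -
  let ?V = "{v. edge_direction P v}"
  define d where "d = w \<times> u"
  have nu: "norm u = 1" using u by (simp add: edge_direction_def)
  then have u0: "u \<noteq> 0" and uu: "u \<bullet> u = 1" by (auto simp: norm_eq_1)
  have ud: "u \<bullet> d = 0" "w \<bullet> d = 0" by (simp_all add: d_def dot_cross_self)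
  have dxu: "d \<times> u = - w"
    using triple_cross_left[OF w(2)] uu cross_skew[of w u] by (simp add: d_def)
  \<comment> \<open>As \<open>u\<close> and \<open>d\<close> span the plane orthogonal to
    \<open>w\<close>, a normal orthogonal to both would be parallel to \<open>w\<close>.\<close>
  have "\<forall>\<^sub>F e in at 0. \<forall>a\<in>facet_normals. a \<times> w \<noteq> 0 \<longrightarrow> u \<bullet> a + e * (d \<bullet> a) \<noteq> 0"
  proof (intro eventually_ball_finite ballI finite_facet_normals)
    fix a
    show "\<forall>\<^sub>F e in at 0. a \<times> w \<noteq> 0 \<longrightarrow> u \<bullet> a + e * (d \<bullet> a) \<noteq> 0"
    proof (cases "a \<times> w = 0")
      case False
      have "u \<bullet> a \<noteq> 0 \<or> d \<bullet> a \<noteq> 0"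
      proof (rule ccontr)
        assume "\<not> (u \<bullet> a \<noteq> 0 \<or> d \<bullet> a \<noteq> 0)"
        then have "a \<bullet> d = 0" "a \<bullet> u = 0" by (simp_all add: inner_commute)
        then obtain c where "a = c *\<^sub>R (d \<times> u)"
          using orthogonal_both_imp_scaleR_cross dxu w(1) by (metis neg_equal_0_iff_equal)
        then show False using False dxu by (simp add: cross_mult_left)
      qed
      then show ?thesis by (rule eventually_mono[OF eventually_affine_nonzero]) simp
    qed simp
  qed
  \<comment> \<open>Both \<open>u \<times> v\<close> and \<open>d \<times> v\<close> are multiples
    of \<open>w\<close>; the first is nonzero and dominates for small \<open>e\<close> of either
    sign, so the ray, and with it the jump of \<open>v\<close>, does not change.\<close>
  moreover have "\<forall>\<^sub>F e in at 0. \<forall>v\<in>?V. w \<bullet> v = 0 \<longrightarrow> v \<noteq> u \<longrightarrow>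
      (\<exists>c>0. (u + e *\<^sub>R d) \<times> v = c *\<^sub>R (u \<times> v))"
  proof (intro eventually_ball_finite ballI finite_edge_directions)
    fix v assume v: "v \<in> ?V"
    show "\<forall>\<^sub>F e in at 0. w \<bullet> v = 0 \<longrightarrow> v \<noteq> u \<longrightarrow> (\<exists>c>0. (u + e *\<^sub>R d) \<times> v = c *\<^sub>R (u \<times> v))"
    proof (cases "w \<bullet> v = 0 \<and> v \<noteq> u")
      case True
      have "u \<times> v \<noteq> 0"
      proof
        assume "u \<times> v = 0"
        then obtain c where "v = c *\<^sub>R u" using cross_eq_0_imp_scaleR u0 by blast
        then have "v = u \<or> v = - u"
          using norm_eq_1_scaleR_cases u v unfolding edge_direction_def by blast
        then show False
          using True u v first_nonzero_pos_uminus[OF u0] unfolding edge_direction_def by blast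
      qed
      then obtain b where b: "w = b *\<^sub>R (u \<times> v)"
        using orthogonal_both_imp_scaleR_cross[of w u v] w True by blast
      then have "b \<noteq> 0" using w by auto
      have "w \<times> (d \<times> v) = (w \<bullet> v) *\<^sub>R d - (w \<bullet> d) *\<^sub>R v"
        using exhaust_3 by (force simp: cross3_simps)
      then have "w \<times> (d \<times> v) = 0" using True ud by simp
      then obtain m where "d \<times> v = m *\<^sub>R w" using cross_eq_0_imp_scaleR w(1) by blast
      then have m: "(u + e *\<^sub>R d) \<times> v = (1 + e * (m * b)) *\<^sub>R (u \<times> v)" for e
        using b by (simp add: cross_add_left cross_mult_left scaleR_add_left)
      have "((\<lambda>e. 1 + e * (m * b)) \<longlongrightarrow> 1 + 0 * (m * b)) (at 0)" by (intro tendsto_intros)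
      then have "\<forall>\<^sub>F e in at 0. 0 < 1 + e * (m * b)" by (rule order_tendstoD) simp
      then show ?thesis by eventually_elim (use m in blast)
    qed simp
  qed
  ultimately have "\<forall>\<^sub>F e in at 0. (\<forall>a\<in>facet_normals. a \<times> w \<noteq> 0 \<longrightarrow> u \<bullet> a + e * (d \<bullet> a) \<noteq> 0) \<and>
     (\<forall>v\<in>?V. w \<bullet> v = 0 \<longrightarrow> v \<noteq> u \<longrightarrow> (\<exists>c>0. (u + e *\<^sub>R d) \<times> v = c *\<^sub>R (u \<times> v)))"
    (is "\<forall>\<^sub>F e in at 0. ?R e") by (rule eventually_conj)
  then obtain \<delta> :: real where \<delta>: "\<delta> > 0" "\<And>e. e \<noteq> 0 \<Longrightarrow> \<bar>e\<bar> < \<delta> \<Longrightarrow> ?R e"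
    by (auto simp: eventually_at dist_real_def)
  define e where "e = \<delta> / 2"
  have e: "e > 0" and R: "?R e" "?R (- e)" using \<delta>(1) \<delta>(2)[of e] \<delta>(2)[of "- e"] by (auto simp: e_def)
  have nonzero: "u + t *\<^sub>R d \<noteq> 0" for t
  proof
    assume *: "u + t *\<^sub>R d = 0"
    have "u \<bullet> (u + t *\<^sub>R d) = 1" by (simp add: inner_add_right uu ud)
    then show False using * by simp
  qed
  have orth: "(u + t *\<^sub>R d) \<bullet> w = 0" for t
    using w(2) ud by (simp add: inner_add_right inner_commute[of _ w])
  have gen: "(u + t *\<^sub>R d) \<bullet> a \<noteq> 0" if "?R t" "a \<in> facet_normals" "a \<times> w \<noteq> 0" for t a
    using that by (simp add: inner_add_left)
  have total: "(\<Sum>v\<in>?V. jump w (u + t *\<^sub>R d) v) = 0" if "?R t" for t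
    using nonzero orth w(1) gen[OF that] by (rule sum_jump)
  have "jump w (u + e *\<^sub>R d) v = jump w (u + (- e) *\<^sub>R d) v" if v: "v \<in> ?V - {u}" for v
  proof (cases "w \<bullet> v = 0")
    case True
    have "jump w (u + t *\<^sub>R d) v = jump w u v" if R: "?R t" for t
    proof -
      obtain c where "c > 0" "(u + t *\<^sub>R d) \<times> v = c *\<^sub>R (u \<times> v)" using R v True by blast
      then show ?thesis by (simp add: jump_def hits_near_scaleR)
    qed
    then show ?thesis using R by metis
  next
    case False
    have "jump w (u + t *\<^sub>R d) v = 0" if "?R t" for t
      using orth w(1) False gen[OF that] by (rule jump_eq_0)
    then show ?thesis using R by metis
  qed
  then have "(\<Sum>v\<in>?V - {u}. jump w (u + e *\<^sub>R d) v) = (\<Sum>v\<in>?V - {u}. jump w (u + (- e) *\<^sub>R d) v)"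
    by (rule sum.cong[OF refl])
  \<comment> \<open>The two zero sums differ at most in the summand of \<open>u\<close>, so its
    jumps agree. But the rays of \<open>u\<close> are opposite for \<open>e\<close> and
    \<open>- e\<close>, so these jumps are also negatives of each other and vanish.\<close>
  then have "jump w (u + e *\<^sub>R d) u = jump w (u + (- e) *\<^sub>R d) u"
    using total[OF R(1)] total[OF R(2)] u finite_edge_directions by (simp add: sum.remove[of ?V u])
  moreover have "(u + e *\<^sub>R d) \<times> u = e *\<^sub>R (- w)" "(u + (- e) *\<^sub>R d) \<times> u = e *\<^sub>R w"
    by (simp_all only: cross_add_left cross_mult_left cross_refl dxu) simp_all
  ultimately show ?thesis
    using e by (simp only: jump_def hits_near_scaleR hits_near_uminus minus_minus)
qed

text \<open>In the basis \<open>w\<close>, \<open>w \<times> u\<close> of the plane orthogonal to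
  \<open>u\<close>, only the sign of the second coordinate of \<open>z\<close> matters.\<close>

lemma hits_near_symmetric:
  assumes u: "edge_direction P u" and w: "w \<bullet> u = 0" and z: "z \<bullet> u = 0" and wz: "w \<times> z \<noteq> 0"
  shows "hits_near u w (- z) = hits_near u w z"
proof -
  have w0: "w \<noteq> 0" using wz by auto
  have u0: "u \<noteq> 0" using u by (auto simp: edge_direction_def)
  have "u \<times> (w \<times> z) = (z \<bullet> u) *\<^sub>R w - (w \<bullet> u) *\<^sub>R z"
    using exhaust_3 by (force simp: cross3_simps)
  then have "u \<times> (w \<times> z) = 0" using w z by simp
  then obtain b where b: "w \<times> z = b *\<^sub>R u" using cross_eq_0_imp_scaleR u0 by blast
  then have "b \<noteq> 0" using wz by auto
  \<comment> \<open>Expanding this product yields the coordinates of \<open>z\<close>, the second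
    one through \<open>w \<times> z = b *\<^sub>R u\<close>.\<close>
  have "(w \<times> z) \<times> w = (w \<bullet> w) *\<^sub>R z - (w \<bullet> z) *\<^sub>R w"
    using exhaust_3 by (force simp: cross3_simps)
  then have "(w \<bullet> w) *\<^sub>R z = (w \<bullet> z) *\<^sub>R w + (- b) *\<^sub>R (w \<times> u)"
    using cross_skew[of w u] by (simp add: b cross_mult_left algebra_simps)
  then have "(1 / (w \<bullet> w)) *\<^sub>R (w \<bullet> w) *\<^sub>R z = (1 / (w \<bullet> w)) *\<^sub>R ((w \<bullet> z) *\<^sub>R w + (- b) *\<^sub>R (w \<times> u))"
    by simp
  then have zeq: "z = ((w \<bullet> z) / (w \<bullet> w)) *\<^sub>R w + (- b / (w \<bullet> w)) *\<^sub>R (w \<times> u)"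
    using w0 by (simp add: scaleR_add_right scaleR_diff_right)
  define \<alpha> \<beta> where "\<alpha> = (w \<bullet> z) / (w \<bullet> w)" and "\<beta> = - b / (w \<bullet> w)"
  have zeq: "z = \<alpha> *\<^sub>R w + \<beta> *\<^sub>R (w \<times> u)" using zeq by (simp add: \<alpha>_def \<beta>_def)
  have "\<beta> \<noteq> 0" using \<open>b \<noteq> 0\<close> w0 by (simp add: \<beta>_def)
  note sym = hits_near_symmetric_cross[OF u w0 w]
  show ?thesis
  proof (cases "\<beta> > 0")
    case True
    have "- z = (- \<alpha>) *\<^sub>R w + \<beta> *\<^sub>R (- (w \<times> u))" by (simp add: zeq)
    then show ?thesis using hits_near_combination[OF True] sym zeq by metis
  next
    case False
    then have neg: "- \<beta> > 0" using \<open>\<beta> \<noteq> 0\<close> by simp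
    have "- z = (- \<alpha>) *\<^sub>R w + (- \<beta>) *\<^sub>R (w \<times> u)" "z = \<alpha> *\<^sub>R w + (- \<beta>) *\<^sub>R (- (w \<times> u))"
      by (simp_all add: zeq)
    then show ?thesis using hits_near_combination[OF neg] sym by metis
  qed
qed

text \<open>Along the segment from \<open>w1\<close> to \<open>w2\<close> the function \<open>hits u\<close> may take other values at the
  finitely many facet normals, but its one-sided limits agree everywhere.\<close>

lemma hits_constant:
  assumes u: "edge_direction P u" and w1: "w1 \<noteq> 0" "w1 \<bullet> u = 0" and w2: "w2 \<noteq> 0" "w2 \<bullet> u = 0"
    and c1: "collinear (support_face P w1)" "collinear (support_face P (- w1))"
    and c2: "collinear (support_face P w2)" "collinear (support_face P (- w2))"
  shows "hits u w1 = hits u w2"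
proof (cases "w1 \<times> w2 = 0")
  case True
  then obtain c where "w2 = c *\<^sub>R w1" using cross_eq_0_imp_scaleR w1(1) by blast
  then show ?thesis using w2(1) hits_scaleR[of c] by auto
next
  case False
  define z where "z = w2 - w1"
  define W where "W t = w1 + t *\<^sub>R z" for t :: real
  have zu: "z \<bullet> u = 0" using w1 w2 by (simp add: z_def inner_diff_left)
  have Wu: "W t \<bullet> u = 0" for t using w1 zu by (simp add: W_def inner_add_left)
  \<comment> \<open>The product is constantly \<open>w1 \<times> w2\<close>, so the line misses the
    origin and \<open>W t\<close> is never parallel to \<open>z\<close>.\<close>
  have Wz: "W t \<times> z \<noteq> 0" for t
    using False by (simp add: W_def z_def cross_add_left cross_mult_left Cross3.right_diff_distrib
        Cross3.left_diff_distrib cross_skew[of w2 w1])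
  \<comment> \<open>The limit at \<open>t\<close>, the same from both sides by
    \<open>hits_near_symmetric\<close>.\<close>
  define G where "G t = hits_near u (W t) z" for t
  have G: "\<forall>\<^sub>F s in at t. hits u (W s) = G t" for t
  proof -
    have "\<forall>\<^sub>F s in at_right 0. hits u (W (t + s)) = G t \<and> hits u (W (t - s)) = G t"
      using eventually_hits[of u "W t" z] eventually_hits[of u "W t" "- z"]
    proof eventually_elim
      case (elim s)
      have "W t + s *\<^sub>R z = W (t + s)" "W t + s *\<^sub>R - z = W (t - s)"
        by (simp_all add: W_def algebra_simps)
      then show ?case
        using elim hits_near_symmetric[OF u Wu zu Wz] by (simp add: G_def)
    qed
    then obtain b where b: "b > 0" "\<And>s. 0 < s \<Longrightarrow> s < b \<Longrightarrow> hits u (W (t + s)) = G t \<and> hits u (W (t - s)) = G t"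
      by (auto simp: eventually_at_right_field)
    have "hits u (W s) = G t" if "s \<noteq> t" "dist s t < b" for s
      using b(2)[of "s - t"] b(2)[of "t - s"] that by (cases "s < t") (auto simp: dist_real_def)
    then show ?thesis using b(1) by (auto simp: eventually_at)
  qed
  have "G 0 = G 1"
  proof (rule connected_local_const[where f = G and A = UNIV])
    show "\<forall>t\<in>UNIV. \<forall>\<^sub>F s in at t within UNIV. G t = G s"
    proof
      fix t
      obtain S where S: "open S" "t \<in> S" "\<And>s. s \<in> S \<Longrightarrow> s \<noteq> t \<Longrightarrow> hits u (W s) = G t"
        using G[of t] by (auto simp: eventually_at_topological)
      \<comment> \<open>Near such an \<open>s\<close> the function takes the value
        \<open>G t\<close>, being inside a punctured neighbourhood of \<open>t\<close>, and also its
        limit \<open>G s\<close>.\<close>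
      have "G t = G s" if s: "s \<in> S" "s \<noteq> t" for s
      proof -
        have "open (S - {t})" "s \<in> S - {t}" using S(1) s by auto
        then have "\<forall>\<^sub>F r in at s. hits u (W r) = G t"
          using S(3) unfolding eventually_at_topological by blast
        with G[of s] have "\<forall>\<^sub>F r in at s. G t = G s" by eventually_elim simp
        then show ?thesis by simp
      qed
      then show "\<forall>\<^sub>F s in at t within UNIV. G t = G s"
        using S(1,2) unfolding eventually_at_topological by blast
    qed
  qed auto
  moreover have "W 0 = w1" "W 1 = w2" by (simp_all add: W_def z_def)
  ultimately show ?thesis
    using hits_near_collinear[OF c1 zu] hits_near_collinear[OF c2 zu] by (simp add: G_def)
qed

text \<open>The value just beyond \<open>w\<close> is attained at vectors supporting no facet, where
  \<open>hits_constant\<close> applies. One number thus describes all one-sided limits, even at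
  facet normals.\<close>

lemma hits_near_eq_hits:
  assumes u: "edge_direction P u" and w1: "w1 \<noteq> 0" "w1 \<bullet> u = 0"
    and c1: "collinear (support_face P w1)" "collinear (support_face P (- w1))"
    and w: "w \<bullet> u = 0" and z: "z \<bullet> u = 0" and wz: "w \<times> z \<noteq> 0"
  shows "hits_near u w z = hits u w1"
proof -
  have "\<forall>\<^sub>F s in at_right (0::real). hits_near u w z = hits u w1"
    using eventually_hits[of u w z] eventually_collinear[OF wz]
  proof eventually_elim
    case (elim s)
    have "(w + s *\<^sub>R z) \<times> z \<noteq> 0" using wz by (simp add: cross_add_left cross_mult_left)
    then have "w + s *\<^sub>R z \<noteq> 0" by auto
    moreover have "(w + s *\<^sub>R z) \<bullet> u = 0" using w z by (simp add: inner_add_left)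
    ultimately have "hits u (w + s *\<^sub>R z) = hits u w1"
      using hits_constant[OF u _ _ w1 _ _ c1] elim(2) by blast
    then show ?case using elim(1) by simp
  qed
  then show ?thesis by simp
qed

section \<open>Multiplicities\<close>

text \<open>A member of the cone is constant on the edge, hence orthogonal to \<open>u\<close>; the
  independent members \<open>w\<close> and \<open>w'\<close> make the cone two-dimensional.\<close>

lemma normal_cone_edge:
  assumes E: "E = support_face P w'" "edge_along E u" and "0 < s"
    and w: "w \<bullet> u = 0" "w \<times> z \<noteq> 0" "w' = w + s *\<^sub>R z" "w \<in> normal_cone P E"
  shows "normal_cone P E \<subseteq> {x. x \<bullet> u = 0}" "aff_dim (normal_cone P E) = 2"
proof -
  show sub: "normal_cone P E \<subseteq> {x. x \<bullet> u = 0}"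
  proof
    fix v assume v: "v \<in> normal_cone P E"
    obtain x y where xy: "x \<in> E" "y \<in> E" "x \<noteq> y" using E(2) by (auto simp: edge_along_def)
    obtain c where c: "x - y = c *\<^sub>R u" using E(2) xy by (auto simp: edge_along_def)
    have "x \<in> P" "y \<in> P" using xy E(1) support_face_subset by blast+
    then have "v \<bullet> x = v \<bullet> y" using v xy by (auto simp: normal_cone_def intro!: order_antisym)
    then have "v \<bullet> (x - y) = 0" by (simp add: inner_diff_right)
    then have "c * (v \<bullet> u) = 0" unfolding c by simp
    moreover have "c \<noteq> 0" using c xy by auto
    ultimately show "v \<in> {x. x \<bullet> u = 0}" by simp
  qed
  have "u \<noteq> 0" using E(2) by (auto simp: edge_along_def)
  then have le: "aff_dim {x. x \<bullet> u = 0} = 2"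
    using aff_dim_hyperplane[of u 0] by (simp add: inner_commute)
  have w': "w' \<in> normal_cone P E" using E(1) by (auto simp: normal_cone_def support_face_def)
  have z0: "0 \<in> normal_cone P E" by (simp add: normal_cone_def)
  have cr: "w \<times> w' = s *\<^sub>R (w \<times> z)" by (simp add: w(3) cross_add_right cross_mult_right)
  have "\<not> collinear {0, w, w'}"
    using cr w(2) \<open>0 < s\<close> by (simp flip: cross_eq_0)
  moreover have "{0, w, w'} \<subseteq> normal_cone P E" using w(4) w' z0 by blast
  ultimately have "\<not> collinear (normal_cone P E)" using collinear_subset by blast
  then have "aff_dim (normal_cone P E) \<ge> 2" by (simp add: collinear_aff_dim)
  then show "aff_dim (normal_cone P E) = 2" using aff_dim_subset[OF sub] le by linarith
qed

text \<open>A functional constant on the face of \<open>w\<close> can be added to \<open>w\<close>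
  in small amounts without leaving the normal cone of \<open>F\<close>, so it is orthogonal to
  \<open>u\<close>. This forces the face to be a segment along \<open>u\<close>.\<close>

lemma edge_along_if_aggregated_cone:
  assumes "u \<noteq> 0" and w: "w \<in> aggregated_cone P u" and col: "collinear (support_face P w)"
  shows "edge_along (support_face P w) u"
proof -
  let ?E = "support_face P w"
  obtain F where F: "F face_of P" "w \<in> normal_cone P F" "normal_cone P F \<subseteq> {x. x \<bullet> u = 0}"
    using w by (auto simp: aggregated_cone_def)
  have FE: "F \<subseteq> ?E"
    using F(2) face_of_imp_subset[OF F(1)] by (auto simp: normal_cone_def support_face_def)
  have orth: "z \<bullet> u = 0" if z: "\<And>x y. x \<in> ?E \<Longrightarrow> y \<in> ?E \<Longrightarrow> z \<bullet> x = z \<bullet> y" for z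
  proof -
    have "\<forall>\<^sub>F s in at_right 0. support_face P (w + s *\<^sub>R z) = ?E"
      using eventually_support_face_perturb[OF polytope_P, of w z] support_face_eq_self[OF z] by simp
    moreover have "\<forall>\<^sub>F s in at_right (0::real). 0 < s" by (simp add: eventually_at_right_less)
    ultimately have "\<forall>\<^sub>F s in at_right (0::real). z \<bullet> u = 0"
    proof eventually_elim
      case (elim s)
      have "w + s *\<^sub>R z \<in> normal_cone P F"
        using FE unfolding elim(1)[symmetric] by (auto simp: normal_cone_def support_face_def)
      then have "(w + s *\<^sub>R z) \<bullet> u = 0" "w \<bullet> u = 0" using F(2,3) by auto
      then show ?case using elim(2) by (simp add: inner_add_left)
    qed
    then show ?thesis by simp
  qed
  have "\<exists>x\<in>?E. \<exists>y\<in>?E. x \<noteq> y"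
  proof (rule ccontr)
    assume "\<not> (\<exists>x\<in>?E. \<exists>y\<in>?E. x \<noteq> y)"
    \<comment> \<open>On a single point every functional is constant, \<open>u\<close>
      included.\<close>
    then have "u \<bullet> u = 0" by (intro orth) metis
    then show False using assms(1) by simp
  qed
  then obtain x y where xy: "x \<in> ?E" "y \<in> ?E" "x \<noteq> y" by blast
  define D where "D = x - y"
  \<comment> \<open>The component of \<open>u\<close> orthogonal to \<open>D\<close> is constant on
    the face, hence orthogonal to \<open>u\<close>, hence zero.\<close>
  define z where "z = u - ((u \<bullet> D) / (D \<bullet> D)) *\<^sub>R D"
  have "D \<noteq> 0" using xy by (simp add: D_def)
  then have zD: "z \<bullet> D = 0" by (simp add: z_def inner_diff_left)
  have "edge_along ?E D"
    by (rule edge_along_if_collinear[OF col xy, of 1]) (simp add: D_def)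
  then have "z \<bullet> u = 0" using edge_along_inner[OF _ zD] by (intro orth) blast
  then have "z \<bullet> z = 0" using zD by (subst (2) z_def) (simp add: inner_diff_right)
  then have u: "u = ((u \<bullet> D) / (D \<bullet> D)) *\<^sub>R D" by (simp add: z_def)
  define b where "b = (u \<bullet> D) / (D \<bullet> D)"
  have "u = b *\<^sub>R D" using u b_def by simp
  moreover have "b \<noteq> 0" using \<open>u = b *\<^sub>R D\<close> assms(1) by auto
  ultimately have "x - y = (1 / b) *\<^sub>R u" by (simp add: D_def)
  then show ?thesis using edge_along_if_collinear[OF col xy] by blast
qed

end

context equiprojective3
begin

text \<open>The count is at least 1, as seen next to the normal of an edge along \<open>u\<close>,
  and at most 2. A full aggregated cone contains both \<open>w1\<close> and \<open>- w1\<close>,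
  which gives 2; conversely, a count of 2 fills the plane with normal cones.\<close>

lemma hits_eq_multiplicity:
  assumes u: "edge_direction P u" and w1: "w1 \<noteq> 0" "w1 \<bullet> u = 0"
    and c1: "collinear (support_face P w1)" "collinear (support_face P (- w1))"
  shows "hits u w1 = int (multiplicity P u)"
proof -
  have u0: "u \<noteq> 0" using u by (auto simp: edge_direction_def)
  have cross: "w \<times> (w \<times> u) \<noteq> 0" if "w \<noteq> 0" "w \<bullet> u = 0" for w
  proof -
    have "w \<times> u \<noteq> 0" using that u0 cross_nonzero_if_orthogonal[of u w] by (simp add: inner_commute)
    then show ?thesis using that dot_cross_self(2) cross_nonzero_if_orthogonal[of "w \<times> u" w]
      by (simp add: dot_cross_self inner_commute)
  qed
  have near: "hits_near u w (w \<times> u) = hits u w1" if "w \<noteq> 0" "w \<bullet> u = 0" for w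
    using hits_near_eq_hits[OF u w1 c1 that(2) _ cross[OF that]] by (simp add: dot_cross_self)
  obtain w0 where w0: "w0 \<noteq> 0" "edge_along (support_face P w0) u"
    using u edge_direction_iff by blast
  have "w0 \<bullet> u = 0" using edge_along_support_face_orthogonal w0(2) by blast
  moreover have "edge_along (support_face (support_face P w0) (w0 \<times> u)) u"
    using w0(2) edge_along_support_face_collinear edge_along_imp_collinear dot_cross_self(3) by blast
  ultimately have pos: "hits u w1 \<ge> 1"
    using near[OF w0(1)] by (auto simp: hits_near_def of_bool_def split: if_splits)
  show ?thesis
  proof (cases "aggregated_cone P u = {x. x \<bullet> u = 0}")
    case True
    have "edge_along (support_face P w1) u" "edge_along (support_face P (- w1)) u"
      by (rule edge_along_if_aggregated_cone; use u0 True w1 c1 in simp)+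
    then show ?thesis using True by (simp add: hits_def multiplicity_def)
  next
    case False
    have "hits u w1 \<noteq> 2"
    proof
      assume two: "hits u w1 = 2"
      \<comment> \<open>With both rays hit everywhere, the face next to \<open>w\<close> on the side
        of \<open>w \<times> u\<close> is an edge along \<open>u\<close>, and its normal cone
        contains \<open>w\<close>.\<close>
      have cone: "\<exists>E. E face_of P \<and> aff_dim (normal_cone P E) = 2 \<and>
          normal_cone P E \<subseteq> {x. x \<bullet> u = 0} \<and> w \<in> normal_cone P E" if w: "w \<noteq> 0" "w \<bullet> u = 0" for w
      proof -
        let ?E = "support_face (support_face P w) (w \<times> u)"
        have edge: "edge_along ?E u"
          using near[OF w] two by (auto simp: hits_near_def of_bool_def split: if_splits)
        have "\<forall>\<^sub>F s in at_right 0. support_face P (w + s *\<^sub>R (w \<times> u)) = ?E \<and> 0 < s"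
          using eventually_support_face_perturb[OF polytope_P]
          by (intro eventually_conj) (simp_all add: eventually_at_right_less)
        then obtain s where s: "support_face P (w + s *\<^sub>R (w \<times> u)) = ?E" "0 < s"
          using eventually_happens' trivial_limit_at_right_real by (metis (mono_tags, lifting))
        have wE: "w \<in> normal_cone P ?E"
          by (auto simp: normal_cone_def support_face_def)
        have "?E face_of P" using s(1) support_face_face_of[OF convex_P] by metis
        then show ?thesis
          using normal_cone_edge[OF s(1)[symmetric] edge s(2) w(2) cross[OF w] refl wE] wE by blast
      qed
      have "{x. x \<bullet> u = 0} \<subseteq> aggregated_cone P u"
      proof
        fix w assume w: "w \<in> {x. x \<bullet> u = 0}"
        obtain E where "E face_of P" "aff_dim (normal_cone P E) = 2"
          "normal_cone P E \<subseteq> {x. x \<bullet> u = 0}" "w \<in> normal_cone P E"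
        proof (cases "w = 0")
          \<comment> \<open>The origin lies in every normal cone, so the one found for
            \<open>w1\<close> serves.\<close>
          case True
          then show ?thesis using cone[OF w1] that by (auto simp: normal_cone_def)
        next
          case False
          then show ?thesis using cone[of w] w that by auto
        qed
        then show "w \<in> aggregated_cone P u" unfolding aggregated_cone_def by blast
      qed
      moreover have "aggregated_cone P u \<subseteq> {x. x \<bullet> u = 0}" unfolding aggregated_cone_def by blast
      ultimately show False using False by blast
    qed
    moreover have "hits u w1 \<le> 2" by (simp add: hits_def)
    ultimately show ?thesis using pos False by (simp add: multiplicity_def)
  qed
qed

end

theorem theorem4p2:
  fixes P :: "(real^3) set"
  assumes "polytope P" and "aff_dim P = 3" and "equiprojective P"
  shows "k_equiprojective P (\<Sum>u\<in>{u. edge_direction P u}. multiplicity P u)"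
proof -
  interpret polytope3 P by unfold_locales (use assms in auto)
  obtain k where k: "k_equiprojective P k" using assms(3) by (auto simp: equiprojective_def)
  interpret equiprojective3 P "int k"
  proof unfold_locales
    fix n :: "real^3" assume n: "n \<noteq> 0" "generic n"
    then have "card {v. v extreme_point_of (proj_plane n ` P)} = k"
      using k unfolding k_equiprojective_def generic_iff by blast
    then show "(\<Sum>v\<in>{v. edge_direction P v}. hits v (n \<times> v)) = int k"
      using card_extreme_points_projection n by metis
  qed
  show ?thesis
    unfolding k_equiprojective_def generic_iff[symmetric]
  proof (intro allI impI)
    fix n :: "real^3" assume n: "n \<noteq> 0" "generic n"
    \<comment> \<open>For generic \<open>n\<close> neither \<open>n \<times> v\<close> nor its
      negative supports a facet, so the constant count can be read off there.\<close>
    have "hits v (n \<times> v) = int (multiplicity P v)" if "edge_direction P v" for v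
    proof -
      have "n \<times> v \<noteq> 0" using generic_cross_edge_direction n that by blast
      moreover have "(n \<times> v) \<bullet> n = 0" "(n \<times> v) \<bullet> v = 0" by (simp_all add: dot_cross_self inner_commute)
      ultimately show ?thesis
        using hits_eq_multiplicity[OF that] generic_collinear[OF n(2)] by simp
    qed
    then have "int (card {v. v extreme_point_of (proj_plane n ` P)}) =
        int (\<Sum>u\<in>{u. edge_direction P u}. multiplicity P u)"
      using card_extreme_points_projection[OF n(2,1)] by simp
    then show "card {v. v extreme_point_of (proj_plane n ` P)} = (\<Sum>u\<in>{u. edge_direction P u}. multiplicity P u)"
      by (simp only: of_nat_eq_iff)
  qed
qed

end
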